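(* Let $p$ be an odd prime, $n\geqslant1$, $1\leqslant k\leqslant n$ and $0\leqslant s_1<\cdots<s_k\leqslant n-1$. For $0\leqslant s\leqslant n$, $$St^{(s),(0)}M_{n,s_1,\ldots,s_k}=\begin{cases}(-1)^{k+s_t-t}\,M_{n,s_1,\ldots,\hat s_t,\ldots,s_k}, & s=s_t \text{ for some } 1\leqslant t\leqslant k,\\[4pt] \displaystyle\sum_{t=1}^{k}(-1)^{n+k+t+1}\,M_{n,s_1,\ldots,\hat s_t,\ldots,s_k}\,Q_{n,s_t}, & s=n,\\[4pt] 0, & \text{otherwise.}\end{cases}$$
   Context: All cohomology has coefficients in $\mathbb Z/p$. $H^*(B(\mathbb Z/p)^n)=E(x_1,\ldots,x_n)\otimes P(y_1,\ldots,y_n)$ with $\dim x_i=1$, $y_i=\beta x_i$ ($\beta$ the Bockstein), $E$ exterior and $P$ polynomial algebra over $\mathbb Z/p$. A hat denotes omission. For non-negative integers $a_{k+1},\ldots,a_n$, define $$[k;a_{k+1},\ldots,a_n]=\sum_I \operatorname{sign}(\sigma_I)\,x_{i_1}\cdots x_{i_k}\,\det\big(y_{i_u}^{p^{a_v}}\big)_{k+1\leqslant u,v\leqslant n},$$ the sum over all $k$-element subsets $I=\{i_1<\cdots<i_k\}$ of $\{1,\ldots,n\}$ with complement $\{i_{k+1}<\cdots<i_n\}$, and $\sigma_I$ the permutation $j\mapsto i_j$. For $k=0$ write $[a_1,\ldots,a_n]=\det(y_i^{p^{a_j}})$. Set $L_{n,s}=[0,\ldots,\hat s,\ldots,n]$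 for $0\leqslant s\leqslant n$, $L_n=L_{n,n}=[0,\ldots,n-1]$. Dickson invariants: $Q_{n,s}=L_{n,s}/L_n$ (a polynomial). M\`ui invariants: for $0\leqslant u_1<\cdots<u_k\leqslant n-1$, $M_{n,u_1,\ldots,u_k}=[k;0,\ldots,\hat u_1,\ldots,\hat u_k,\ldots,n-1]$; with an empty list of indices ($k=0$) this is $[0,\ldots,n-1]=L_n$. Let $\mathcal A(p)$ be the mod $p$ Steenrod algebra. Its dual is $\mathcal A(p)^*=E(\tau_0,\tau_1,\ldots)\otimes P(\xi_1,\xi_2,\ldots)$ (Milnor), $\dim\tau_s=2p^s-1$, $\dim\xi_i=2p^i-2$. It has the basis of monomials $\tau_S\xi^R=\tau_{s_1}\cdots\tau_{s_t}\xi_1^{r_1}\cdots\xi_m^{r_m}$ ($S=(s_1,\ldots,s_t)$, $0\leqslant s_1<\cdots<s_t$, $R=(r_1,\ldots,r_m)$), and $St^{S,R}\in\mathcal A(p)$ is the element of the dual basis dual to $\tau_S\xi^R$; so $St^{(s),(0)}$ is dual to $\tau_s$. The action (Milnor's sign convention) is determined as follows: the ring homomorphism $\lambda:H^*(B(\mathbb Z/p)^n)\to H^*(B(\mathbb Z/p)^n)\widehat\otimes\mathcal A(p)^*$ (graded tensor product with Koszul signs) given by $\lambda(x_i)=x_i\otimes1+\sum_{s\geqslant0}y_i^{p^s}\otimes\tau_s$, $\lambda(y_i)=\sum_{s\geqslant0}y_i^{p^s}\otimes\xi_s$ ($\xi_0=1$) satisfies $\lambda(u)=\sum_{S,R}(-1)^{t(\dim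 u-t)}St^{S,R}u\otimes\tau_S\xi^R$, where $t$ is the length of $S$. *)

theory Defs
  imports
    "HOL-Library.Poly_Mapping"
    "HOL-Combinatorics.Permutations"
    "Jordan_Normal_Form.Determinant"
    "Berlekamp_Zassenhaus.Finite_Field"
begin

section \<open>Graded-commutative series over a graded ring\<close>

text \<open>
  Only the parity of degrees enters the Koszul signs. A graded-commutative ring is given with its
  grading automorphism \<open>parity\<close>, which multiplies an element of degree \<open>d\<close> by \<open>(-1)^d\<close>.
\<close>

class supercomm_ring = ring_1 +
  fixes parity :: "'a \<Rightarrow> 'a"
  assumes parity_add: "parity (a + b) = parity a + parity b"
    and parity_mult: "parity (a * b) = parity a * parity b"
    and parity_parity: "parity (parity a) = a"
    and even_commute: "parity a = a \<Longrightarrow> a * b = b * a"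
    and odd_commute: "parity a = - a \<Longrightarrow> a * parity b = b * a"
begin

lemma parity_one: "parity 1 = 1"
proof -
  have "parity 1 = parity 1 * parity (parity 1)" by (simp add: parity_parity)
  also have "\<dots> = parity (1 * parity 1)" by (simp only: parity_mult)
  finally show ?thesis by (simp add: parity_parity)
qed

lemma parity_zero: "parity 0 = 0"
  using parity_add[of 0 0] by simp

lemma parity_uminus: "parity (- a) = - parity a"
  using parity_add[of a "- a"] parity_zero by (simp add: eq_neg_iff_add_eq_0 add.commute)

lemma parity_sum: "parity (sum f A) = (\<Sum>i\<in>A. parity (f i))"
  by (induction A rule: infinite_finite_induct) (simp_all add: parity_add parity_zero)

lemma parity_pow_add: "(parity ^^ k) (a + b) = (parity ^^ k) a + (parity ^^ k) b"
  by (induction k) (simp_all add: parity_add)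

lemma parity_pow_mult: "(parity ^^ k) (a * b) = (parity ^^ k) a * (parity ^^ k) b"
  by (induction k) (simp_all add: parity_mult)

lemma parity_pow_zero: "(parity ^^ k) 0 = 0"
  by (induction k) (simp_all add: parity_zero)

lemma parity_pow_one: "(parity ^^ k) 1 = 1"
  by (induction k) (simp_all add: parity_one)

lemma parity_pow_uminus: "(parity ^^ k) (- a) = - (parity ^^ k) a"
  by (induction k) (simp_all add: parity_uminus)

lemma parity_pow_sum: "(parity ^^ k) (sum f A) = (\<Sum>i\<in>A. (parity ^^ k) (f i))"
  by (induction k) (simp_all add: parity_sum)

lemma parity_pow_parity: "(parity ^^ k) (parity a) = parity ((parity ^^ k) a)"
  by (induction k) simp_all

end

instantiation mod_ring :: (nontriv) supercomm_ring
begin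

definition "parity (a :: 'a mod_ring) = a"

instance by standard (simp_all add: parity_mod_ring_def mult.commute)

end

text \<open>
  The pair \<open>(S, R)\<close> stands for the monomial \<open>\<tau>_S \<xi>^R\<close> in odd variables \<open>\<tau>_i\<close> (increasing product
  over the finite set \<open>S\<close>) and even variables \<open>\<xi>_i\<close> (with exponents \<open>R\<close>), or likewise \<open>x_S y^R\<close>.
\<close>

type_synonym gmono = "nat set \<times> (nat \<Rightarrow>\<^sub>0 nat)"

text \<open>The factorizations of a monomial, up to sign, into two monomials.\<close>

definition splits :: "gmono \<Rightarrow> (gmono \<times> gmono) set" where
  "splits m = {(l, r). fst l \<inter> fst r = {} \<and> fst l \<union> fst r = fst m \<and> snd l + snd r = snd m}"

text \<open>For disjoint \<open>A\<close> and \<open>B\<close> one has \<open>\<tau>_A \<tau>_B = (-1)^(crossings A B) \<tau>_(A \<union> B)\<close>.\<close>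

definition crossings :: "nat set \<Rightarrow> nat set \<Rightarrow> nat" where
  "crossings A B = card {(i, j). i \<in> A \<and> j \<in> B \<and> j < i}"

lemma crossings_Un_left:
  assumes "finite A" "finite B" "finite C" "A \<inter> B = {}"
  shows "crossings (A \<union> B) C = crossings A C + crossings B C"
proof -
  have fin: "finite {(i, j). i \<in> X \<and> j \<in> C \<and> j < i}" if "finite X" for X :: "nat set"
    by (rule finite_subset[of _ "X \<times> C"]) (use that assms in auto)
  have "{(i, j). i \<in> A \<union> B \<and> j \<in> C \<and> j < i}
      = {(i, j). i \<in> A \<and> j \<in> C \<and> j < i} \<union> {(i, j). i \<in> B \<and> j \<in> C \<and> j < i}"
    by auto
  then show ?thesis
    unfolding crossings_def using assms fin by (simp add: card_Un_disjoint disjoint_iff)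
qed

lemma crossings_Un_right:
  assumes "finite A" "finite B" "finite C" "B \<inter> C = {}"
  shows "crossings A (B \<union> C) = crossings A B + crossings A C"
proof -
  have fin: "finite {(i, j). i \<in> A \<and> j \<in> X \<and> j < i}" if "finite X" for X :: "nat set"
    by (rule finite_subset[of _ "A \<times> X"]) (use that assms in auto)
  have "{(i, j). i \<in> A \<and> j \<in> B \<union> C \<and> j < i}
      = {(i, j). i \<in> A \<and> j \<in> B \<and> j < i} \<union> {(i, j). i \<in> A \<and> j \<in> C \<and> j < i}"
    by auto
  then show ?thesis
    unfolding crossings_def using assms fin by (simp add: card_Un_disjoint disjoint_iff)
qed

lemma crossings_swap:
  assumes "finite A" "finite B" "A \<inter> B = {}"
  shows "crossings A B + crossings B A = card A * card B"
proof -
  have "A \<times> B = {(i, j). i \<in> A \<and> j \<in> B \<and> j < i} \<union> prod.swap ` {(i, j). i \<in> B \<and> j \<in> A \<and> j < i}"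
    using assms(3) by (force simp: image_iff)
  moreover have "finite {(i, j). i \<in> A \<and> j \<in> B \<and> j < i}" "finite {(i, j). i \<in> B \<and> j \<in> A \<and> j < i}"
    by (rule finite_subset[of _ "A \<times> B"] finite_subset[of _ "B \<times> A"]; use assms in auto)+
  ultimately have "card (A \<times> B) = card {(i, j). i \<in> A \<and> j \<in> B \<and> j < i}
      + card (prod.swap ` {(i, j). i \<in> B \<and> j \<in> A \<and> j < i})"
    by (simp only:) (subst card_Un_disjoint; auto)
  then show ?thesis
    by (simp add: crossings_def card_image inj_on_def card_cartesian_product prod.swap_def
        split_beta)
qed

lemma crossings_empty [simp]: "crossings {} A = 0" "crossings A {} = 0"
  by (simp_all add: crossings_def)

lemma splits_finite_iff:
  "(l, r) \<in> splits m \<Longrightarrow> finite (fst m) \<longleftrightarrow> finite (fst l) \<and> finite (fst r)"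
  by (auto simp: splits_def simp flip: finite_Un)

lemma splits_card:
  "(l, r) \<in> splits m \<Longrightarrow> finite (fst m) \<Longrightarrow> card (fst m) = card (fst l) + card (fst r)"
  using card_Un_disjoint[of "fst l" "fst r"] splits_finite_iff[of l r m] by (auto simp: splits_def)

lemma finite_add_eq: "finite {(a, b). a + b = c}"
  for c :: "nat \<Rightarrow>\<^sub>0 nat"
proof -
  let ?K = "Poly_Mapping.keys c" and ?L = "Poly_Mapping.lookup"
  define N where "N = (\<Sum>i\<in>?K. ?L c i)"
  let ?F = "{f :: nat \<Rightarrow> nat. \<forall>i. (i \<in> ?K \<longrightarrow> f i \<in> {..N}) \<and> (i \<notin> ?K \<longrightarrow> f i = 0)}"
  have "?L a i \<le> N" if "i \<in> ?K" "a + b = c" for a b i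
  proof -
    have "?L a i \<le> ?L c i" using that(2) by (auto simp: lookup_add)
    also have "\<dots> \<le> N" unfolding N_def by (rule member_le_sum) (use that in auto)
    finally show ?thesis .
  qed
  moreover have "?L a i = 0" if "i \<notin> ?K" "a + b = c" for a b i
    using that by (auto simp: in_keys_iff lookup_add)
  ultimately have "?L ` fst ` {(a, b). a + b = c} \<subseteq> ?F" by auto
  moreover have "finite ?F" by (rule finite_set_of_finite_funs) auto
  ultimately have "finite (?L ` fst ` {(a, b). a + b = c})" by (rule finite_subset)
  then have "finite (fst ` {(a, b). a + b = c})"
    by (rule finite_imageD) (auto simp: inj_on_def lookup_inject)
  then show ?thesis
    by (rule finite_imageD) (auto simp: inj_on_def)
qed

lemma finite_splits:
  assumes "finite (fst m)"
  shows "finite (splits m)"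
proof -
  have "finite ((Pow (fst m) \<times> Pow (fst m)) \<times> {(a, b). a + b = snd m})"
    using assms finite_add_eq by blast
  then have "finite ((\<lambda>((A, B), (a, b)). ((A, a), (B, b))) `
      ((Pow (fst m) \<times> Pow (fst m)) \<times> {(a, b). a + b = snd m}))"
    by (rule finite_imageI)
  then show ?thesis
    by (rule rev_finite_subset) (force simp: splits_def image_iff)
qed

lemma sum_splits_assoc:
  fixes F :: "gmono \<Rightarrow> gmono \<Rightarrow> gmono \<Rightarrow> 'b :: comm_monoid_add"
  assumes "finite (fst m)"
  shows "(\<Sum>(l, r)\<in>splits m. \<Sum>(a, b)\<in>splits l. F a b r)
       = (\<Sum>(a, s)\<in>splits m. \<Sum>(b, r)\<in>splits s. F a b r)"
proof -
  have fin: "finite (splits (fst z))" "finite (splits (snd z))" if "z \<in> splits m" for z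
  proof -
    have "fst (fst z) \<subseteq> fst m" "fst (snd z) \<subseteq> fst m" using that by (auto simp: splits_def)
    then show "finite (splits (fst z))" "finite (splits (snd z))"
      using assms by (auto intro!: finite_splits dest: finite_subset)
  qed
  have "(\<Sum>(l, r)\<in>splits m. \<Sum>(a, b)\<in>splits l. F a b r)
      = (\<Sum>(z, w)\<in>Sigma (splits m) (\<lambda>z. splits (fst z)). F (fst w) (snd w) (snd z))"
    using fin finite_splits[OF assms] by (subst sum.Sigma[symmetric]) (auto simp: case_prod_beta)
  also have "\<dots> = (\<Sum>(z, w)\<in>Sigma (splits m) (\<lambda>z. splits (snd z)). F (fst z) (fst w) (snd w))"
    by (rule sum.reindex_bij_witness[where
          i = "\<lambda>((a, s), (b, r)). (((fst a \<union> fst b, snd a + snd b), r), (a, b))" and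
          j = "\<lambda>((l, r), (a, b)). ((a, (fst b \<union> fst r, snd b + snd r)), (b, r))"])
       (auto simp: splits_def add.assoc)
  also have "\<dots> = (\<Sum>(a, s)\<in>splits m. \<Sum>(b, r)\<in>splits s. F a b r)"
    using fin finite_splits[OF assms] by (subst sum.Sigma[symmetric]) (auto simp: case_prod_beta)
  finally show ?thesis .
qed

text \<open>
  \<open>'a gseries\<close> is the ring of all formal sums \<open>\<Sum> c_m \<otimes> m\<close> over monomials \<open>m = \<tau>_S \<xi>^R\<close> with
  coefficients \<open>c_m\<close> in \<open>'a\<close>, i.e. the completed graded tensor product of \<open>'a\<close> with
  \<open>E(\<tau>_0, \<tau>_1, \<dots>) \<otimes> P(\<xi>_0, \<xi>_1, \<dots>)\<close>, where
  \<open>(c \<otimes> m)(c' \<otimes> m') = (-1)^(deg m deg c') (c c') \<otimes> (m m')\<close>.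
\<close>

typedef (overloaded) 'a gseries = "{f :: gmono \<Rightarrow> 'a :: zero. \<forall>m. infinite (fst m) \<longrightarrow> f m = 0}"
  morphisms gcoeff Abs_gseries
  by (rule exI[of _ "\<lambda>_. 0"]) simp

setup_lifting type_definition_gseries

lemma gseries_eqI:
  assumes "\<And>m. finite (fst m) \<Longrightarrow> gcoeff f m = gcoeff g m"
  shows "f = g"
  using assms by transfer (metis ext mem_Collect_eq)

lemma minus_one_power_mult: "(- 1) ^ k * (a :: 'a :: ring_1) = (if even k then a else - a)"
  by simp

lemma gseries_times_closed:
  fixes f g :: "gmono \<Rightarrow> 'a :: supercomm_ring"
  assumes f: "\<And>m. infinite (fst m) \<Longrightarrow> f m = 0"
    and g: "\<And>m. infinite (fst m) \<Longrightarrow> g m = 0"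
    and m: "infinite (fst m)"
  shows "(\<Sum>(l, r)\<in>splits m. (- 1) ^ crossings (fst l) (fst r) *
        (f l * (parity ^^ card (fst l)) (g r))) = 0"
proof (intro sum.neutral ballI, clarify)
  fix A a B b
  assume s: "((A, a), (B, b)) \<in> splits m"
  have "infinite A \<or> infinite B" using m splits_finite_iff[OF s] by simp
  then have "f (A, a) = 0 \<or> g (B, b) = 0" using f g by auto
  then show "(- 1) ^ crossings (fst (A, a)) (fst (B, b)) *
      (f (A, a) * (parity ^^ card (fst (A, a))) (g (B, b))) = 0"
    by (auto simp: parity_pow_zero)
qed

instantiation gseries :: (supercomm_ring) ring_1
begin

lift_definition zero_gseries :: "'a gseries" is "\<lambda>_. 0" by simp

lift_definition one_gseries :: "'a gseries" is "\<lambda>m. if m = ({}, 0) then 1 else 0" by auto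

lift_definition plus_gseries :: "'a gseries \<Rightarrow> 'a gseries \<Rightarrow> 'a gseries"
  is "\<lambda>f g m. f m + g m" by simp

lift_definition uminus_gseries :: "'a gseries \<Rightarrow> 'a gseries" is "\<lambda>f m. - f m" by simp

lift_definition minus_gseries :: "'a gseries \<Rightarrow> 'a gseries \<Rightarrow> 'a gseries"
  is "\<lambda>f g m. f m - g m" by simp

lift_definition times_gseries :: "'a gseries \<Rightarrow> 'a gseries \<Rightarrow> 'a gseries"
  is "\<lambda>f g m. \<Sum>(l, r)\<in>splits m. (- 1) ^ crossings (fst l) (fst r) *
        (f l * (parity ^^ card (fst l)) (g r))"
  by (rule gseries_times_closed)

instance
proof
  fix f g h :: "'a gseries"
  show "f * g * h = f * (g * h)"
  proof (rule gseries_eqI, transfer)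
    fix f g h :: "gmono \<Rightarrow> 'a" and m :: gmono
    assume m: "finite (fst m)"
    define F where "F a b r = (- 1) ^ (crossings (fst a) (fst b) + crossings (fst a) (fst r)
        + crossings (fst b) (fst r)) * (f a * (parity ^^ card (fst a)) (g b)
        * (parity ^^ (card (fst a) + card (fst b))) (h r))" for a b r
    have "(\<Sum>(l, r)\<in>splits m. (- 1) ^ crossings (fst l) (fst r) *
        ((\<Sum>(a, b)\<in>splits l. (- 1) ^ crossings (fst a) (fst b) *
            (f a * (parity ^^ card (fst a)) (g b))) * (parity ^^ card (fst l)) (h r)))
      = (\<Sum>(l, r)\<in>splits m. \<Sum>(a, b)\<in>splits l. F a b r)"
    proof (intro sum.cong refl, clarify)
      fix A x B y
      assume *: "((A, x), (B, y)) \<in> splits m"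
      have "F a b (B, y) = (- 1) ^ crossings A B * ((- 1) ^ crossings (fst a) (fst b) *
            (f a * (parity ^^ card (fst a)) (g b)) * (parity ^^ card A) (h (B, y)))"
        if "(a, b) \<in> splits (A, x)" for a b
      proof -
        have A: "A = fst a \<union> fst b" "fst a \<inter> fst b = {}" using that by (auto simp: splits_def)
        have fin: "finite (fst a)" "finite (fst b)" "finite B"
          using * m A by (auto simp: splits_def dest: finite_subset[rotated])
        have "crossings A B = crossings (fst a) B + crossings (fst b) B"
          "card A = card (fst a) + card (fst b)"
          using fin A by (simp_all add: crossings_Un_left card_Un_disjoint)
        then show ?thesis by (simp add: F_def minus_one_power_mult)
      qed
      then show "(- 1) ^ crossings (fst (A, x)) (fst (B, y)) *
          ((\<Sum>(a, b)\<in>splits (A, x). (- 1) ^ crossings (fst a) (fst b) *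
            (f a * (parity ^^ card (fst a)) (g b))) * (parity ^^ card (fst (A, x))) (h (B, y)))
          = (\<Sum>(a, b)\<in>splits (A, x). F a b (B, y))"
        unfolding sum_distrib_left sum_distrib_right
        by (intro sum.cong refl) (auto simp: case_prod_beta)
    qed
    also have "\<dots> = (\<Sum>(a, s)\<in>splits m. \<Sum>(b, r)\<in>splits s. F a b r)"
      by (rule sum_splits_assoc[OF m])
    also have "\<dots> = (\<Sum>(l, r)\<in>splits m. (- 1) ^ crossings (fst l) (fst r) *
        (f l * (parity ^^ card (fst l)) (\<Sum>(a, b)\<in>splits r. (- 1) ^ crossings (fst a) (fst b) *
            (g a * (parity ^^ card (fst a)) (h b)))))"
    proof (intro sum.cong refl, clarify)
      fix A x B y
      assume *: "((A, x), (B, y)) \<in> splits m"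
      have "F (A, x) b r = (- 1) ^ crossings A B * (f (A, x) * (parity ^^ card A)
          ((- 1) ^ crossings (fst b) (fst r) * (g b * (parity ^^ card (fst b)) (h r))))"
        if "(b, r) \<in> splits (B, y)" for b r
      proof -
        have B: "B = fst b \<union> fst r" "fst b \<inter> fst r = {}" using that by (auto simp: splits_def)
        have fin: "finite (fst b)" "finite (fst r)" "finite A"
          using * m B by (auto simp: splits_def dest: finite_subset[rotated])
        have "crossings A B = crossings A (fst b) + crossings A (fst r)"
          using fin B by (simp_all add: crossings_Un_right)
        then show ?thesis
          by (simp add: F_def minus_one_power_mult parity_pow_mult parity_pow_uminus funpow_add
              mult.assoc)
      qed
      then show "(\<Sum>(b, r)\<in>splits (B, y). F (A, x) b r) = (- 1) ^ crossings (fst (A, x)) (fst (B, y)) *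
        (f (A, x) * (parity ^^ card (fst (A, x))) (\<Sum>(a, b)\<in>splits (B, y).
          (- 1) ^ crossings (fst a) (fst b) * (g a * (parity ^^ card (fst a)) (h b))))"
        unfolding sum_distrib_left parity_pow_sum
        by (intro sum.cong refl) (auto simp: case_prod_beta)
    qed
    finally show "(\<Sum>(l, r)\<in>splits m. (- 1) ^ crossings (fst l) (fst r) *
        ((\<Sum>(a, b)\<in>splits l. (- 1) ^ crossings (fst a) (fst b) *
            (f a * (parity ^^ card (fst a)) (g b))) * (parity ^^ card (fst l)) (h r)))
      = (\<Sum>(l, r)\<in>splits m. (- 1) ^ crossings (fst l) (fst r) *
        (f l * (parity ^^ card (fst l)) (\<Sum>(a, b)\<in>splits r. (- 1) ^ crossings (fst a) (fst b) *
            (g a * (parity ^^ card (fst a)) (h b)))))" .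
  qed
  show "f + g + h = f + (g + h)" by transfer (simp add: add.assoc)
  show "f + g = g + f" by transfer (simp add: add.commute)
  show "0 + f = f" by transfer simp
  show "- f + f = 0" by transfer simp
  show "f - g = f + - g" by transfer simp
  show "1 * f = f"
  proof (rule gseries_eqI, transfer)
    fix f :: "gmono \<Rightarrow> 'a" and m :: gmono
    assume m: "finite (fst m)"
    have "(\<Sum>(l, r)\<in>splits m. (- 1) ^ crossings (fst l) (fst r) *
        ((if l = ({}, 0) then 1 else 0) * (parity ^^ card (fst l)) (f r)))
      = (\<Sum>(l, r)\<in>{(({}, 0), m) :: gmono \<times> gmono}. (- 1) ^ crossings (fst l) (fst r) *
        ((if l = ({}, 0) then 1 else 0) * (parity ^^ card (fst l)) (f r)))"
      by (rule sum.mono_neutral_right, rule finite_splits[OF m])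
         (auto simp: splits_def prod_eq_iff split: if_splits)
    then show "(\<Sum>(l, r)\<in>splits m. (- 1) ^ crossings (fst l) (fst r) *
        ((if l = ({}, 0) then 1 else 0) * (parity ^^ card (fst l)) (f r))) = f m"
      by simp
  qed
  show "f * 1 = f"
  proof (rule gseries_eqI, transfer)
    fix f :: "gmono \<Rightarrow> 'a" and m :: gmono
    assume m: "finite (fst m)"
    have "(\<Sum>(l, r)\<in>splits m. (- 1) ^ crossings (fst l) (fst r) *
        (f l * (parity ^^ card (fst l)) (if r = ({}, 0) then 1 else 0)))
      = (\<Sum>(l, r)\<in>{(m, ({}, 0)) :: gmono \<times> gmono}. (- 1) ^ crossings (fst l) (fst r) *
        (f l * (parity ^^ card (fst l)) (if r = ({}, 0) then 1 else 0)))"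
      by (rule sum.mono_neutral_right, rule finite_splits[OF m])
         (auto simp: splits_def prod_eq_iff parity_pow_zero split: if_splits)
    then show "(\<Sum>(l, r)\<in>splits m. (- 1) ^ crossings (fst l) (fst r) *
        (f l * (parity ^^ card (fst l)) (if r = ({}, 0) then 1 else 0))) = f m"
      by (simp add: parity_pow_one)
  qed
  show "(f + g) * h = f * h + g * h"
    by (rule gseries_eqI, transfer)
       (simp add: case_prod_beta sum.distrib[symmetric] algebra_simps)
  show "f * (g + h) = f * g + f * h"
    by (rule gseries_eqI, transfer)
       (simp add: case_prod_beta sum.distrib[symmetric] algebra_simps parity_pow_add)
  show "(0 :: 'a gseries) \<noteq> 1"
    by transfer (metis zero_neq_one)
qed

end

lemma sum_splits_swap: "(\<Sum>(l, r)\<in>splits m. F l r) = (\<Sum>(l, r)\<in>splits m. F r l)"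
  by (rule sum.reindex_bij_witness[of _ prod.swap prod.swap]) (auto simp: splits_def add.commute)

lemma gseries_commute_aux:
  fixes f g :: "gmono \<Rightarrow> 'a :: supercomm_ring"
  assumes m: "finite (fst m)"
    and f: "\<And>l. (- 1) ^ card (fst l) * parity (f l) = (if even k then f l else - f l)"
  shows "(\<Sum>(l, r)\<in>splits m. (- 1) ^ crossings (fst l) (fst r) *
          (f l * (parity ^^ card (fst l)) ((- 1) ^ (k * card (fst r)) * (if even k then g r else parity (g r)))))
       = (\<Sum>(l, r)\<in>splits m. (- 1) ^ crossings (fst l) (fst r) *
          (g l * (parity ^^ card (fst l)) (f r)))"
proof -
  have P2: "(parity ^^ j) a = (if even j then a else parity a)" for j and a :: 'a
    by (induction j) (auto simp: parity_parity)
  have "(- 1) ^ crossings (fst l) (fst r) *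
          (f l * (parity ^^ card (fst l)) ((- 1) ^ (k * card (fst r)) * (if even k then g r else parity (g r))))
      = (- 1) ^ crossings (fst r) (fst l) * (g r * (parity ^^ card (fst r)) (f l))"
    if lr: "(l, r) \<in> splits m" for l r
  proof -
    have "finite (fst l)" "finite (fst r)" "fst l \<inter> fst r = {}"
      using lr m splits_finite_iff[OF lr] by (auto simp: splits_def)
    from crossings_swap[OF this]
    have cr: "even (crossings (fst r) (fst l)) \<longleftrightarrow>
        (even (crossings (fst l) (fst r)) \<longleftrightarrow> even (card (fst l) * card (fst r)))"
      by (metis even_add)
    have pf: "parity (f l) = (if even k = even (card (fst l)) then f l else - f l)"
      using f[of l] by (cases "even (card (fst l))"; cases "even k") (auto simp: minus_equation_iff)
    show ?thesis
    proof (cases "even k = even (card (fst l))")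
      case True
      then have "f l * b = b * f l" for b using even_commute[of "f l" b] pf by simp
      then show ?thesis using True pf cr
        by (cases "even k"; cases "even (card (fst r))")
           (auto simp: P2 minus_one_power_mult parity_parity parity_uminus)
    next
      case False
      then have "f l * parity b = b * f l" for b using odd_commute[of "f l" b] pf by simp
      then show ?thesis using False pf cr
        by (cases "even k"; cases "even (card (fst r))")
           (auto simp: P2 minus_one_power_mult parity_parity parity_uminus)
    qed
  qed
  then show ?thesis
    by (subst (2) sum_splits_swap) (intro sum.cong refl, auto)
qed

instantiation gseries :: (supercomm_ring) supercomm_ring
begin

lift_definition parity_gseries :: "'a gseries \<Rightarrow> 'a gseries"
  is "\<lambda>f m. (- 1) ^ card (fst m) * parity (f m)" by (simp add: parity_zero)

instance
proof
  fix f g :: "'a gseries"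
  show "parity (f + g) = parity f + parity g"
    by transfer (simp add: parity_add algebra_simps)
  show "parity (parity f) = f"
    by transfer (auto simp: minus_one_power_mult parity_parity parity_uminus)
  show "f * g = g * f" if "parity f = f"
    using that
  proof (intro gseries_eqI, transfer)
    fix f g :: "gmono \<Rightarrow> 'a" and m :: gmono
    assume m: "finite (fst m)" and f: "(\<lambda>m. (- 1) ^ card (fst m) * parity (f m)) = f"
    show "(\<Sum>(l, r)\<in>splits m. (- 1) ^ crossings (fst l) (fst r) *
        (f l * (parity ^^ card (fst l)) (g r))) = (\<Sum>(l, r)\<in>splits m.
        (- 1) ^ crossings (fst l) (fst r) * (g l * (parity ^^ card (fst l)) (f r)))"
      using gseries_commute_aux[OF m, of f 0 g] fun_cong[OF f] by simp
  qed
  show "f * parity g = g * f" if "parity f = - f"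
    using that
  proof (intro gseries_eqI, transfer)
    fix f g :: "gmono \<Rightarrow> 'a" and m :: gmono
    assume m: "finite (fst m)" and f: "(\<lambda>m. (- 1) ^ card (fst m) * parity (f m)) = (\<lambda>m. - f m)"
    show "(\<Sum>(l, r)\<in>splits m. (- 1) ^ crossings (fst l) (fst r) *
        (f l * (parity ^^ card (fst l)) ((- 1) ^ card (fst r) * parity (g r)))) =
        (\<Sum>(l, r)\<in>splits m. (- 1) ^ crossings (fst l) (fst r) *
        (g l * (parity ^^ card (fst l)) (f r)))"
      using gseries_commute_aux[OF m, of f 1 g] fun_cong[OF f] by simp
  qed
  show "parity (f * g) = parity f * parity g"
  proof (rule gseries_eqI, transfer)
    fix f g :: "gmono \<Rightarrow> 'a" and m :: gmono
    assume m: "finite (fst m)"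
    show "(- 1) ^ card (fst m) * parity (\<Sum>(l, r)\<in>splits m. (- 1) ^ crossings (fst l) (fst r) *
        (f l * (parity ^^ card (fst l)) (g r)))
      = (\<Sum>(l, r)\<in>splits m. (- 1) ^ crossings (fst l) (fst r) *
        ((- 1) ^ card (fst l) * parity (f l) *
          (parity ^^ card (fst l)) ((- 1) ^ card (fst r) * parity (g r))))"
      unfolding parity_sum sum_distrib_left
    proof (intro sum.cong refl, clarify)
      fix A x B y
      assume *: "((A, x), (B, y)) \<in> splits m"
      have "card (fst m) = card A + card B"
        using splits_card[OF * m] by simp
      then show "(- 1) ^ card (fst m) * parity ((- 1) ^ crossings (fst (A, x)) (fst (B, y)) *
          (f (A, x) * (parity ^^ card (fst (A, x))) (g (B, y))))
        = (- 1) ^ crossings (fst (A, x)) (fst (B, y)) *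
          ((- 1) ^ card (fst (A, x)) * parity (f (A, x)) *
          (parity ^^ card (fst (A, x))) ((- 1) ^ card (fst (B, y)) * parity (g (B, y))))"
        by (simp add: minus_one_power_mult parity_mult parity_uminus parity_pow_uminus
            parity_pow_parity)
    qed
  qed
qed

end

text \<open>The homogeneous element \<open>c \<otimes> m\<close>.\<close>

definition gterm :: "'a :: zero \<Rightarrow> gmono \<Rightarrow> 'a gseries" where
  "gterm c m = Abs_gseries (\<lambda>m'. if m' = m \<and> finite (fst m) then c else 0)"

lemma gcoeff_gterm: "gcoeff (gterm c m) m' = (if m' = m \<and> finite (fst m) then c else 0)"
  unfolding gterm_def by (subst Abs_gseries_inverse) auto

text \<open>The formal sum of a family in which every monomial occurs only finitely often.\<close>

lift_definition gsum :: "(nat \<Rightarrow> 'a :: comm_monoid_add gseries) \<Rightarrow> 'a gseries"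
  is "\<lambda>F m. \<Sum>s | F s m \<noteq> 0. F s m" by simp


section \<open>The algebra \<open>E(x_1, x_2, \<dots>) \<otimes> P(y_1, y_2, \<dots>)\<close>\<close>

text \<open>
  \<open>'a gpoly\<close> is the subring of finite sums, \<open>E(x_0, x_1, \<dots>) \<otimes> P(y_0, y_1, \<dots>)\<close> over \<open>'a\<close>.
  The cohomology of \<open>B(Z/p)^n\<close> is its subalgebra \<open>cohomology n\<close> on the generators with indices
  \<open>1, \<dots>, n\<close>; the formulas for the coaction do not depend on \<open>n\<close>.
\<close>

typedef (overloaded) 'a gpoly = "{f :: 'a :: zero gseries. finite {m. gcoeff f m \<noteq> 0}}"
proof -
  have "gcoeff (gterm 0 ({}, 0) :: 'a gseries) m = 0" for m by (simp add: gcoeff_gterm)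
  then show ?thesis by (intro exI[of _ "gterm 0 ({}, 0)"]) simp
qed

setup_lifting type_definition_gpoly

instantiation gpoly :: (supercomm_ring) supercomm_ring
begin

lift_definition zero_gpoly :: "'a gpoly" is 0 by (simp add: zero_gseries.rep_eq)

lift_definition one_gpoly :: "'a gpoly" is 1 by (simp add: one_gseries.rep_eq)

lift_definition plus_gpoly :: "'a gpoly \<Rightarrow> 'a gpoly \<Rightarrow> 'a gpoly" is "(+)"
proof -
  fix f g :: "'a gseries"
  assume "finite {m. gcoeff f m \<noteq> 0}" "finite {m. gcoeff g m \<noteq> 0}"
  then have "finite ({m. gcoeff f m \<noteq> 0} \<union> {m. gcoeff g m \<noteq> 0})" by simp
  then show "finite {m. gcoeff (f + g) m \<noteq> 0}"
    by (rule rev_finite_subset) (auto simp: plus_gseries.rep_eq)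
qed

lift_definition uminus_gpoly :: "'a gpoly \<Rightarrow> 'a gpoly" is uminus
  by (simp add: uminus_gseries.rep_eq)

lift_definition minus_gpoly :: "'a gpoly \<Rightarrow> 'a gpoly \<Rightarrow> 'a gpoly" is "(-)"
proof -
  fix f g :: "'a gseries"
  assume "finite {m. gcoeff f m \<noteq> 0}" "finite {m. gcoeff g m \<noteq> 0}"
  then have "finite ({m. gcoeff f m \<noteq> 0} \<union> {m. gcoeff g m \<noteq> 0})" by simp
  then show "finite {m. gcoeff (f - g) m \<noteq> 0}"
    by (rule rev_finite_subset) (auto simp: minus_gseries.rep_eq)
qed

lift_definition times_gpoly :: "'a gpoly \<Rightarrow> 'a gpoly \<Rightarrow> 'a gpoly" is "(*)"
proof -
  fix f g :: "'a gseries"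
  assume "finite {m. gcoeff f m \<noteq> 0}" "finite {m. gcoeff g m \<noteq> 0}"
  then have "finite ((\<lambda>(l, r). (fst l \<union> fst r, snd l + snd r)) `
      ({m. gcoeff f m \<noteq> 0} \<times> {m. gcoeff g m \<noteq> 0}))" by simp
  then show "finite {m. gcoeff (f * g) m \<noteq> 0}"
  proof (rule rev_finite_subset, intro subsetI)
    fix m assume "m \<in> {m. gcoeff (f * g) m \<noteq> 0}"
    then obtain l r where lr: "(l, r) \<in> splits m"
      "gcoeff f l * (parity ^^ card (fst l)) (gcoeff g r) \<noteq> 0"
      by (force simp: times_gseries.rep_eq dest!: sum.not_neutral_contains_not_neutral)
    then have "gcoeff f l \<noteq> 0" "gcoeff g r \<noteq> 0" by (auto simp: parity_pow_zero)
    moreover have "m = (\<lambda>(l, r). (fst l \<union> fst r, snd l + snd r)) (l, r)"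
      using lr by (auto simp: splits_def prod_eq_iff)
    ultimately show "m \<in> (\<lambda>(l, r). (fst l \<union> fst r, snd l + snd r)) `
        ({m. gcoeff f m \<noteq> 0} \<times> {m. gcoeff g m \<noteq> 0})"
      by blast
  qed
qed

lift_definition parity_gpoly :: "'a gpoly \<Rightarrow> 'a gpoly" is parity
proof -
  fix f :: "'a gseries"
  assume "finite {m. gcoeff f m \<noteq> 0}"
  then show "finite {m. gcoeff (parity f) m \<noteq> 0}"
    by (rule rev_finite_subset) (auto simp: parity_gseries.rep_eq parity_zero)
qed

instance
proof
  fix a b c :: "'a gpoly"
  show "a * b * c = a * (b * c)" by transfer (rule mult.assoc)
  show "a + b + c = a + (b + c)" by transfer (rule add.assoc)
  show "a + b = b + a" by transfer (rule add.commute)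
  show "0 + a = a" by transfer (rule add_0_left)
  show "- a + a = 0" by transfer (rule left_minus)
  show "a - b = a + - b" by transfer (rule diff_conv_add_uminus)
  show "1 * a = a" by transfer (rule mult_1_left)
  show "a * 1 = a" by transfer (rule mult_1_right)
  show "(a + b) * c = a * c + b * c" by transfer (rule distrib_right)
  show "a * (b + c) = a * b + a * c" by transfer (rule distrib_left)
  show "(0 :: 'a gpoly) \<noteq> 1" by transfer (rule zero_neq_one)
  show "parity (a + b) = parity a + parity b" by transfer (rule parity_add)
  show "parity (a * b) = parity a * parity b" by transfer (rule parity_mult)
  show "parity (parity a) = a" by transfer (rule parity_parity)
  show "a * b = b * a" if "parity a = a" using that by transfer (rule even_commute)
  show "a * parity b = b * a" if "parity a = - a" using that by transfer (rule odd_commute)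
qed

end

definition pcoeff :: "'a :: zero gpoly \<Rightarrow> gmono \<Rightarrow> 'a" where
  "pcoeff u m = gcoeff (Rep_gpoly u) m"

definition pterm :: "'a :: zero \<Rightarrow> gmono \<Rightarrow> 'a gpoly" where
  "pterm c m = Abs_gpoly (gterm c m)"

lemma pcoeff_pterm: "pcoeff (pterm c m) m' = (if m' = m \<and> finite (fst m) then c else 0)"
proof -
  have "finite {m'. gcoeff (gterm c m) m' \<noteq> 0}"
    by (rule finite_subset[of _ "{m}"]) (auto simp: gcoeff_gterm)
  then show ?thesis by (simp add: pcoeff_def pterm_def Abs_gpoly_inverse gcoeff_gterm)
qed

definition support :: "'a :: zero gpoly \<Rightarrow> gmono set" where
  "support u = {m. pcoeff u m \<noteq> 0}"

definition cohomology :: "nat \<Rightarrow> 'a :: zero gpoly set" where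
  "cohomology n = {u. \<forall>(S, R)\<in>support u. S \<subseteq> {1..n} \<and> Poly_Mapping.keys R \<subseteq> {1..n}}"

definition xgen :: "nat \<Rightarrow> 'a :: supercomm_ring gpoly" where
  "xgen i = pterm 1 ({i}, 0)"

definition ygen :: "nat \<Rightarrow> 'a :: supercomm_ring gpoly" where
  "ygen i = pterm 1 ({}, Poly_Mapping.single i 1)"

text \<open>The cohomological degree of \<open>x_S y^R\<close>.\<close>

definition mdim :: "gmono \<Rightarrow> nat" where
  "mdim m = card (fst m) + 2 * (\<Sum>i\<in>Poly_Mapping.keys (snd m). Poly_Mapping.lookup (snd m) i)"

type_synonym 'a ypoly = "(nat \<Rightarrow>\<^sub>0 nat) \<Rightarrow>\<^sub>0 'a"

definition yvar :: "nat \<Rightarrow> 'a :: comm_ring_1 ypoly" where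
  "yvar i = Poly_Mapping.single (Poly_Mapping.single i 1) 1"

text \<open>The inclusion of \<open>P(y_0, y_1, \<dots>)\<close>.\<close>

definition of_ypoly :: "'a :: supercomm_ring ypoly \<Rightarrow> 'a gpoly" where
  "of_ypoly q = (\<Sum>R\<in>Poly_Mapping.keys q. pterm (Poly_Mapping.lookup q R) ({}, R))"


section \<open>The Milnor coaction and the operations \<open>St\<^bsup>S,R\<^esup>\<close>\<close>

text \<open>
  An element of \<open>'p mod_ring gpoly gseries\<close> is a formal sum of terms \<open>u \<otimes> \<tau>_S \<xi>^R\<close>. Since \<open>\<xi>_0 = 1\<close>,
  the exponent of the variable with index 0 is always 0.
\<close>

definition tau :: "nat \<Rightarrow> gmono" where
  "tau s = ({s}, 0)"

definition xi :: "nat \<Rightarrow> gmono" where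
  "xi s = ({}, if s = 0 then 0 else Poly_Mapping.single s 1)"

text \<open>
  \<open>coaction\<close> is \<open>\<lambda>\<close>. It is defined on the monomial basis by multiplying the values on the
  generators; for odd \<open>p\<close> it is multiplicative, see \<open>coaction_mult\<close> below.
\<close>

definition coaction_x :: "nat \<Rightarrow> 'p :: prime_card mod_ring gpoly gseries" where
  "coaction_x i = gterm (xgen i) ({}, 0) + gsum (\<lambda>s. gterm (ygen i ^ (CARD('p) ^ s)) (tau s))"

definition coaction_y :: "nat \<Rightarrow> 'p :: prime_card mod_ring gpoly gseries" where
  "coaction_y i = gsum (\<lambda>s. gterm (ygen i ^ (CARD('p) ^ s)) (xi s))"

definition coaction_mono :: "gmono \<Rightarrow> 'p :: prime_card mod_ring gpoly gseries" where
  "coaction_mono m = prod_list (map coaction_x (sorted_list_of_set (fst m))) *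
     prod_list (map (\<lambda>i. coaction_y i ^ Poly_Mapping.lookup (snd m) i)
       (sorted_list_of_set (Poly_Mapping.keys (snd m))))"

definition coaction :: "'p :: prime_card mod_ring gpoly \<Rightarrow> 'p mod_ring gpoly gseries" where
  "coaction u = (\<Sum>m\<in>support u. gterm (pterm (pcoeff u m) ({}, 0)) ({}, 0) * coaction_mono m)"

text \<open>
  The relation between \<open>coaction\<close> and the operations holds for homogeneous \<open>u\<close>; hence the operations
  are defined on terms \<open>c x_I y^J\<close> and extended additively. The sign is \<open>(-1)^(t (d - t))\<close>, with
  \<open>d + t\<close> in place of \<open>d - t\<close> to stay in the natural numbers.
\<close>

definition milnor_op :: "nat set \<Rightarrow> (nat \<Rightarrow>\<^sub>0 nat) \<Rightarrow>
    'p :: prime_card mod_ring gpoly \<Rightarrow> 'p mod_ring gpoly" where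
  "milnor_op S R u = (\<Sum>m\<in>support u. (- 1) ^ (card S * (mdim m + card S)) *
     gcoeff (coaction (pterm (pcoeff u m) m)) (S, R))"


section \<open>Dickson and Mui invariants\<close>

text \<open>
  For lists \<open>is\<close> and \<open>as\<close> of the same length, the determinant with entries \<open>y_(is_u)^(p^(as_v))\<close>.
\<close>

definition ydet :: "nat list \<Rightarrow> nat list \<Rightarrow> 'p :: prime_card mod_ring ypoly" where
  "ydet is as = det (mat (length as) (length as)
     (\<lambda>(u, v). yvar (is ! u) ^ (CARD('p) ^ (as ! v))))"

text \<open>The permutation \<open>j \<mapsto> i_j\<close> of \<open>{1..n}\<close> listing \<open>I\<close> and then its complement, each in order.\<close>

definition bracket_perm :: "nat \<Rightarrow> nat set \<Rightarrow> nat \<Rightarrow> nat" where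
  "bracket_perm n I j = (if j \<in> {1..n}
     then (sorted_list_of_set I @ sorted_list_of_set ({1..n} - I)) ! (j - 1) else j)"

text \<open>
  \<open>bracket k as\<close> is \<open>[k; a_(k+1), \<dots>, a_n]\<close>; here \<open>n\<close> is determined by the length of the list.
\<close>

definition bracket :: "nat \<Rightarrow> nat list \<Rightarrow> 'p :: prime_card mod_ring gpoly" where
  "bracket k as = (let n = k + length as in
     \<Sum>I | I \<subseteq> {1..n} \<and> card I = k. of_int (sign (bracket_perm n I)) *
       prod_list (map xgen (sorted_list_of_set I)) *
       of_ypoly (ydet (sorted_list_of_set ({1..n} - I)) as))"

definition Ldet :: "nat \<Rightarrow> nat \<Rightarrow> 'p :: prime_card mod_ring ypoly" where
  "Ldet n s = ydet [1..<n + 1] (filter (\<lambda>j. j \<noteq> s) [0..<n + 1])"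

text \<open>The exact quotient \<open>L_(n,s) / L_n\<close> in the integral domain \<open>P(y_0, y_1, \<dots>)\<close>.\<close>

definition dickson :: "nat \<Rightarrow> nat \<Rightarrow> 'p :: prime_card mod_ring ypoly" where
  "dickson n s = (THE q. q * Ldet n n = Ldet n s)"

definition mui :: "nat \<Rightarrow> nat list \<Rightarrow> 'p :: prime_card mod_ring gpoly" where
  "mui n us = bracket (length us) (filter (\<lambda>j. j \<notin> set us) [0..<n])"


section \<open>The coaction is a ring homomorphism\<close>

lemma gpoly_eqI:
  assumes "\<And>m. finite (fst m) \<Longrightarrow> pcoeff u m = pcoeff v m"
  shows "u = v"
  using assms gseries_eqI[of "Rep_gpoly u" "Rep_gpoly v"] by (simp add: pcoeff_def Rep_gpoly_inject)

lemma pcoeff_infinite: "infinite (fst m) \<Longrightarrow> pcoeff u m = 0"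
  using gcoeff[of "Rep_gpoly u"] by (cases m) (auto simp: pcoeff_def)

lemma finite_support: "finite (support u)"
  using Rep_gpoly[of u] by (simp add: support_def pcoeff_def)

lemma finite_fst_support: "m \<in> support u \<Longrightarrow> finite (fst m)"
  using pcoeff_infinite[of m u] by (auto simp: support_def)

lemma pcoeff_add: "pcoeff (u + v) m = pcoeff u m + pcoeff v m"
  by (simp add: pcoeff_def plus_gpoly.rep_eq plus_gseries.rep_eq)

lemma pcoeff_zero: "pcoeff 0 m = 0"
  by (simp add: pcoeff_def zero_gpoly.rep_eq zero_gseries.rep_eq)

lemma gcoeff_sum: "gcoeff (sum f A) m = (\<Sum>i\<in>A. gcoeff (f i) m)"
  by (induction A rule: infinite_finite_induct) (simp_all add: plus_gseries.rep_eq zero_gseries.rep_eq)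

lemma pcoeff_sum: "pcoeff (sum f A) m = (\<Sum>i\<in>A. pcoeff (f i) m)"
  by (induction A rule: infinite_finite_induct) (simp_all add: pcoeff_add pcoeff_zero)

lemma Rep_pterm: "Rep_gpoly (pterm c m) = gterm c m"
  using pcoeff_pterm[of c m] by (intro gseries_eqI) (simp add: pcoeff_def gcoeff_gterm)

lemma gterm_zero: "gterm 0 m = 0"
  by (rule gseries_eqI) (simp add: gcoeff_gterm zero_gseries.rep_eq)

lemma gterm_add: "gterm (a + b) m = gterm a m + gterm b m"
  by (rule gseries_eqI) (simp add: gcoeff_gterm plus_gseries.rep_eq)

lemma pterm_zero: "pterm 0 m = 0"
  by (rule gpoly_eqI) (simp add: pcoeff_pterm pcoeff_zero)

lemma pterm_add: "pterm (a + b) m = pterm a m + pterm b m"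
  by (rule gpoly_eqI) (simp add: pcoeff_pterm pcoeff_add)

lemma gterm_mult:
  assumes "finite (fst l)" "finite (fst r)"
  shows "gterm a l * gterm b r = (if fst l \<inter> fst r = {} then
    gterm ((- 1) ^ crossings (fst l) (fst r) * (a * (parity ^^ card (fst l)) b))
      (fst l \<union> fst r, snd l + snd r) else 0)"
proof (rule gseries_eqI)
  fix m :: gmono
  assume m: "finite (fst m)"
  have "gcoeff (gterm a l * gterm b r) m
      = (\<Sum>z\<in>splits m. if z = (l, r) then
          (- 1) ^ crossings (fst l) (fst r) * (a * (parity ^^ card (fst l)) b) else 0)"
    unfolding times_gseries.rep_eq
    by (intro sum.cong refl) (auto simp: gcoeff_gterm assms parity_pow_zero split: if_splits)
  also have "\<dots> = (if (l, r) \<in> splits m then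
          (- 1) ^ crossings (fst l) (fst r) * (a * (parity ^^ card (fst l)) b) else 0)"
    using finite_splits[OF m] by simp
  finally show "gcoeff (gterm a l * gterm b r) m
      = gcoeff (if fst l \<inter> fst r = {} then
    gterm ((- 1) ^ crossings (fst l) (fst r) * (a * (parity ^^ card (fst l)) b))
      (fst l \<union> fst r, snd l + snd r) else 0) m"
    using assms by (auto simp: gcoeff_gterm splits_def zero_gseries.rep_eq prod_eq_iff)
qed

lemma pterm_mult:
  assumes "finite (fst l)" "finite (fst r)"
  shows "pterm a l * pterm b r = (if fst l \<inter> fst r = {} then
    pterm ((- 1) ^ crossings (fst l) (fst r) * (a * (parity ^^ card (fst l)) b))
      (fst l \<union> fst r, snd l + snd r) else 0)"
  using gterm_mult[OF assms, of a b]
  by (simp flip: Rep_gpoly_inject add: times_gpoly.rep_eq Rep_pterm zero_gpoly.rep_eq split: if_splits)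

lemma pterm_decomp: "u = (\<Sum>m\<in>support u. pterm (pcoeff u m) m)"
proof (rule gpoly_eqI)
  fix m :: gmono
  assume m: "finite (fst m)"
  have "pcoeff (\<Sum>m\<in>support u. pterm (pcoeff u m) m) m
      = (\<Sum>m'\<in>support u. if m' = m then pcoeff u m else 0)"
    unfolding pcoeff_sum by (intro sum.cong refl) (auto simp: pcoeff_pterm m)
  then show "pcoeff u m = pcoeff (\<Sum>m\<in>support u. pterm (pcoeff u m) m) m"
    using finite_support[of u] by (auto simp: support_def)
qed

text \<open>The scalars \<open>c \<otimes> 1\<close>.\<close>

definition cst :: "'p :: prime_card mod_ring \<Rightarrow> 'p mod_ring gpoly gseries" where
  "cst c = gterm (pterm c ({}, 0)) ({}, 0)"

lemma cst_zero: "cst 0 = 0"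
  by (simp add: cst_def pterm_zero gterm_zero)

lemma cst_add: "cst (a + b) = cst a + cst b"
  by (simp add: cst_def pterm_add gterm_add)

lemma cst_uminus: "cst (- a) = - cst a"
  using cst_add[of a "- a"] by (simp add: cst_zero eq_neg_iff_add_eq_0 add.commute)

lemma cst_mult: "cst (a * b) = cst a * cst b"
  by (simp add: cst_def pterm_mult gterm_mult)

lemma gterm_one: "gterm 1 ({}, 0) = 1"
  by (rule gseries_eqI) (simp add: gcoeff_gterm one_gseries.rep_eq)

lemma pterm_one: "pterm 1 ({}, 0) = 1"
  by (simp flip: Rep_gpoly_inject add: Rep_pterm one_gpoly.rep_eq gterm_one)

lemma cst_one: "cst 1 = 1"
  by (simp add: cst_def pterm_one gterm_one)

lemma parity_gterm: "parity (gterm a m) = gterm ((- 1) ^ card (fst m) * parity a) m"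
  by (rule gseries_eqI) (simp add: parity_gseries.rep_eq gcoeff_gterm parity_zero)

lemma parity_pterm: "parity (pterm a m) = pterm ((- 1) ^ card (fst m) * parity a) m"
  by (simp flip: Rep_gpoly_inject add: parity_gpoly.rep_eq Rep_pterm parity_gterm)

lemma cst_commute: "cst c * u = u * cst c"
  by (rule even_commute) (simp add: cst_def parity_gterm parity_pterm parity_mod_ring_def)

lemma parity_xgen: "parity (xgen i :: 'p :: prime_card mod_ring gpoly) = - xgen i"
proof -
  have "pterm (- 1) ({i}, 0) = - pterm (1 :: 'p mod_ring) ({i}, 0)"
    using pterm_add[of "1 :: 'p mod_ring" "- 1" "({i}, 0)"]
    by (simp add: eq_neg_iff_add_eq_0 pterm_zero add.commute)
  then show ?thesis by (simp add: xgen_def parity_pterm parity_mod_ring_def)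
qed

lemma parity_ygen_power: "parity ((ygen i :: 'p :: prime_card mod_ring gpoly) ^ k) = ygen i ^ k"
  by (induction k) (simp_all add: parity_one parity_mult ygen_def parity_pterm parity_mod_ring_def)

lemma parity_gsum: "parity (gsum F) = gsum (\<lambda>s. parity (F s))"
proof (rule gseries_eqI)
  fix m :: gmono
  have 1: "gcoeff (parity (F s)) m = 0 \<longleftrightarrow> gcoeff (F s) m = 0" for s
    by (auto simp: parity_gseries.rep_eq minus_one_power_mult parity_zero)
       (metis parity_parity parity_zero)+
  show "gcoeff (parity (gsum F)) m = gcoeff (gsum (\<lambda>s. parity (F s))) m"
    unfolding gsum.rep_eq 1
    by (simp add: parity_gseries.rep_eq gsum.rep_eq parity_sum sum_distrib_left)
qed

lemma gsum_uminus: "gsum (\<lambda>s. - F s) = - gsum F"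
  by (rule gseries_eqI) (simp add: gsum.rep_eq uminus_gseries.rep_eq sum_negf)

lemma gterm_uminus: "gterm (- a) m = - gterm (a :: 'a :: supercomm_ring) m"
  by (rule gseries_eqI) (simp add: gcoeff_gterm uminus_gseries.rep_eq)

lemma parity_coaction_x: "parity (coaction_x i) = - coaction_x i"
  unfolding coaction_x_def
  by (simp add: parity_add parity_gsum parity_gterm parity_xgen parity_ygen_power tau_def
      gterm_uminus gsum_uminus)

lemma parity_coaction_y: "parity (coaction_y i) = coaction_y i"
  unfolding coaction_y_def
  by (simp add: parity_gsum parity_gterm parity_ygen_power xi_def)

lemma mod_ring_double_zero:
  assumes "odd CARD('p :: prime_card)" "c + c = (0 :: 'p mod_ring)"
  shows "c = 0"
proof -
  obtain q where q: "CARD('p) = 2 * q + 1" using assms(1) by (elim oddE)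
  have "0 = of_nat CARD('p) * c" unfolding of_nat_card_eq_0 by (rule mult_zero_left[symmetric])
  also have "\<dots> = (of_nat q + of_nat q + 1) * c" unfolding q mult_2 of_nat_add of_nat_1 ..
  also have "\<dots> = of_nat q * (c + c) + c" unfolding distrib_left distrib_right mult_1_left ..
  also have "\<dots> = c" unfolding assms(2) by simp
  finally show ?thesis ..
qed

lemma coaction_x_square:
  assumes "odd CARD('p :: prime_card)"
  shows "coaction_x i * (coaction_x i :: 'p mod_ring gpoly gseries) = 0"
proof -
  let ?u = "coaction_x i * (coaction_x i :: 'p mod_ring gpoly gseries)"
  have "- ?u = ?u" using odd_commute[OF parity_coaction_x, of i "coaction_x i"]
    by (simp add: parity_coaction_x)
  then have u: "?u + ?u = 0" by (metis neg_eq_iff_add_eq_0)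
  have "pcoeff (gcoeff ?u m) m' = 0" for m m'
  proof (rule mod_ring_double_zero[OF assms])
    have "gcoeff (?u + ?u) m = 0" by (simp add: u zero_gseries.rep_eq)
    then have "pcoeff (gcoeff ?u m + gcoeff ?u m) m' = 0"
      by (simp add: plus_gseries.rep_eq pcoeff_zero)
    then show "pcoeff (gcoeff ?u m) m' + pcoeff (gcoeff ?u m) m' = 0" by (simp add: pcoeff_add)
  qed
  then have "gcoeff ?u m = 0" for m by (intro gpoly_eqI) (simp add: pcoeff_zero)
  then show ?thesis by (intro gseries_eqI) (simp add: zero_gseries.rep_eq)
qed

lemma coaction_x_anticommute:
  "coaction_x i * coaction_x j = - (coaction_x j * (coaction_x i :: 'p :: prime_card mod_ring gpoly gseries))"
proof -
  have "coaction_x j * parity (coaction_x i)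
      = coaction_x i * (coaction_x j :: 'p mod_ring gpoly gseries)"
    by (rule odd_commute) (rule parity_coaction_x)
  then show ?thesis by (simp add: parity_coaction_x)
qed

definition coaction_X :: "nat set \<Rightarrow> 'p :: prime_card mod_ring gpoly gseries" where
  "coaction_X S = prod_list (map coaction_x (sorted_list_of_set S))"

definition coaction_Y :: "(nat \<Rightarrow>\<^sub>0 nat) \<Rightarrow> 'p :: prime_card mod_ring gpoly gseries" where
  "coaction_Y R = prod_list (map (\<lambda>i. coaction_y i ^ Poly_Mapping.lookup R i)
     (sorted_list_of_set (Poly_Mapping.keys R)))"

lemma coaction_mono_eq: "coaction_mono (S, R) = coaction_X S * coaction_Y R"
  by (simp add: coaction_mono_def coaction_X_def coaction_Y_def)

lemma coaction_X_insert:
  assumes "finite S" "\<And>i. i \<in> S \<Longrightarrow> j < i"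
  shows "coaction_X (insert j S) = coaction_x j * coaction_X S"
proof -
  have "j \<notin> S" using assms(2)[of j] by auto
  then have "sorted_list_of_set (insert j S) = j # sorted_list_of_set S"
    using assms by (simp add: insort_is_Cons less_imp_le)
  then show ?thesis by (simp add: coaction_X_def)
qed

lemma coaction_x_X:
  assumes "odd CARD('p :: prime_card)" "finite S"
  shows "coaction_x j * (coaction_X S :: 'p mod_ring gpoly gseries)
    = (if j \<in> S then 0 else (- 1) ^ crossings {j} S * coaction_X (insert j S))"
  using assms(2)
proof (induction S rule: finite_linorder_min_induct)
  case empty
  then show ?case by (simp add: coaction_X_def)
next
  case (insert b A)
  have X: "coaction_X (insert b A) = coaction_x b * (coaction_X A :: 'p mod_ring gpoly gseries)"
    using insert by (intro coaction_X_insert) auto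
  consider "j < b" | "j = b" | "b < j" by linarith
  then show ?case
  proof cases
    case 1
    then have "coaction_X (insert j (insert b A))
        = coaction_x j * (coaction_X (insert b A) :: 'p mod_ring gpoly gseries)"
      using insert by (intro coaction_X_insert) (auto intro: less_trans)
    moreover have "crossings {j} (insert b A) = 0"
      unfolding crossings_def card_eq_0_iff
      using 1 insert.hyps(2) by (auto dest: less_trans)
    moreover have "j \<notin> insert b A" using 1 insert.hyps(2) by (auto dest: less_trans)
    ultimately show ?thesis by simp
  next
    case 2
    then show ?thesis using coaction_x_square[OF assms(1), of b] by (simp add: X mult.assoc[symmetric])
  next
    case 3
    have c: "crossings {j} (insert b A) = crossings {j} A + 1"
    proof -
      have "{(i, k). i \<in> {j} \<and> k \<in> {b} \<and> k < i} = {(j, b)}" using 3 by auto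
      then have "crossings {j} {b} = 1" by (simp add: crossings_def)
      then show ?thesis
        using crossings_Un_right[of "{j}" "{b}" A] insert.hyps by auto
    qed
    have "coaction_x j * (coaction_X (insert b A) :: 'p mod_ring gpoly gseries)
        = - (coaction_x b * (coaction_x j * coaction_X A))"
      by (simp add: X mult.assoc[symmetric] coaction_x_anticommute[of j b])
    also have "\<dots> = (if j \<in> A then 0
        else - ((- 1) ^ crossings {j} A * (coaction_x b * coaction_X (insert j A))))"
      by (simp add: insert.IH minus_one_power_mult)
    also have "coaction_x b * coaction_X (insert j A)
        = (coaction_X (insert j (insert b A)) :: 'p mod_ring gpoly gseries)"
      using insert 3 by (subst insert_commute) (intro coaction_X_insert[symmetric], auto)
    finally show ?thesis using 3 by (simp add: c)
  qed
qed

lemma coaction_X_mult: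
  assumes "odd CARD('p :: prime_card)" "finite S" "finite S'"
  shows "(coaction_X S :: 'p mod_ring gpoly gseries) * coaction_X S'
    = (if S \<inter> S' = {} then (- 1) ^ crossings S S' * coaction_X (S \<union> S') else 0)"
  using assms(2)
proof (induction S rule: finite_linorder_min_induct)
  case empty
  then show ?case by (simp add: coaction_X_def)
next
  case (insert b A)
  have X: "coaction_X (insert b A) = coaction_x b * (coaction_X A :: 'p mod_ring gpoly gseries)"
    using insert by (intro coaction_X_insert) auto
  have b: "b \<notin> A" using insert by auto
  have "coaction_X (insert b A) * (coaction_X S' :: 'p mod_ring gpoly gseries)
      = (if A \<inter> S' = {} then (- 1) ^ crossings A S' * (coaction_x b * coaction_X (A \<union> S')) else 0)"
    by (simp add: X mult.assoc insert.IH minus_one_power_mult)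
  also have "\<dots> = (if A \<inter> S' = {} \<and> b \<notin> S' then
      (- 1) ^ (crossings A S' + crossings {b} (A \<union> S')) * coaction_X (insert b (A \<union> S')) else 0)"
    using coaction_x_X[OF assms(1), of "A \<union> S'" b] insert.hyps(1) assms(3) b
    by (auto simp: minus_one_power_mult)
  also have "\<dots> = (if insert b A \<inter> S' = {} then
      (- 1) ^ crossings (insert b A) S' * coaction_X (insert b A \<union> S') else 0)"
  proof (cases "A \<inter> S' = {} \<and> b \<notin> S'")
    case True
    have "crossings {b} A = 0"
      unfolding crossings_def card_eq_0_iff using insert.hyps(2) by auto
    then have "crossings {b} (A \<union> S') = crossings {b} S'"
      using crossings_Un_right[of "{b}" A S'] True insert.hyps(1) assms(3) by simp
    moreover have "crossings (insert b A) S' = crossings {b} S' + crossings A S'"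
      using crossings_Un_left[of "{b}" A S'] b insert.hyps(1) assms(3) by simp
    ultimately show ?thesis using True by (simp add: add.commute)
  qed auto
  finally show ?case .
qed

lemma coaction_y_power_commute: "coaction_y i ^ k * u = u * coaction_y i ^ k"
proof (rule even_commute)
  show "parity (coaction_y i ^ k) = coaction_y i ^ k"
    by (induction k) (simp_all add: parity_one parity_mult parity_coaction_y)
qed

lemma coaction_Y_superset:
  assumes "finite K" "Poly_Mapping.keys R \<subseteq> K"
  shows "coaction_Y R = prod_list (map (\<lambda>i. coaction_y i ^ Poly_Mapping.lookup R i) (sorted_list_of_set K))"
proof -
  have "sorted_list_of_set (Poly_Mapping.keys R)
      = filter (\<lambda>i. i \<in> Poly_Mapping.keys R) (sorted_list_of_set K)"
    using assms by (intro sorted_distinct_set_unique) (auto intro: sorted_wrt_filter)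
  moreover have "prod_list (map (\<lambda>i. coaction_y i ^ Poly_Mapping.lookup R i)
        (filter (\<lambda>i. i \<in> Poly_Mapping.keys R) xs))
      = (prod_list (map (\<lambda>i. coaction_y i ^ Poly_Mapping.lookup R i) xs)
          :: 'a mod_ring gpoly gseries)" for xs
    by (induction xs) (auto simp: in_keys_iff)
  ultimately show ?thesis by (simp add: coaction_Y_def)
qed

lemma mult_commute_closed:
  assumes "a * u = u * a" "b * u = u * (b :: 'a :: ring_1)"
  shows "a * b * u = u * (a * b)"
  unfolding mult.assoc assms(2) unfolding mult.assoc[symmetric] assms(1) ..

lemma coaction_Y_commute: "coaction_Y R * u = u * coaction_Y R"
proof -
  have "prod_list (map (\<lambda>i. coaction_y i ^ Poly_Mapping.lookup R i) xs) * u
      = u * prod_list (map (\<lambda>i. coaction_y i ^ Poly_Mapping.lookup R i) xs)" for xs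
  proof (induction xs)
    case (Cons i xs)
    then show ?case
      unfolding list.map prod_list.Cons by (intro mult_commute_closed coaction_y_power_commute)
  qed simp
  then show ?thesis by (simp add: coaction_Y_def)
qed

lemma coaction_Y_mult:
  "coaction_Y R * coaction_Y R' = (coaction_Y (R + R') :: 'p :: prime_card mod_ring gpoly gseries)"
proof -
  let ?K = "Poly_Mapping.keys R \<union> Poly_Mapping.keys R'"
  let ?P = "\<lambda>R xs. prod_list (map (\<lambda>i. coaction_y i ^ Poly_Mapping.lookup R i) xs)
    :: 'p mod_ring gpoly gseries"
  have "?P R xs * ?P R' xs = ?P (R + R') xs" for xs
  proof (induction xs)
    case (Cons i xs)
    have "coaction_y i ^ Poly_Mapping.lookup R i * ?P R xs *
        (coaction_y i ^ Poly_Mapping.lookup R' i * ?P R' xs)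
      = coaction_y i ^ Poly_Mapping.lookup R i *
        (coaction_y i ^ Poly_Mapping.lookup R' i * ?P R xs) * ?P R' xs"
      by (simp add: coaction_y_power_commute[of i "Poly_Mapping.lookup R' i" "?P R xs"] mult.assoc)
    also have "\<dots> = coaction_y i ^ Poly_Mapping.lookup (R + R') i * (?P R xs * ?P R' xs)"
      by (simp add: lookup_add power_add mult.assoc)
    finally show ?case unfolding list.map prod_list.Cons Cons.IH .
  qed simp
  moreover have "Poly_Mapping.keys (R + R') \<subseteq> ?K" by (rule keys_add)
  ultimately show ?thesis by (simp add: coaction_Y_superset[of ?K])
qed

lemma coaction_mono_mult:
  assumes "odd CARD('p :: prime_card)" "finite (fst l)" "finite (fst r)"
  shows "(coaction_mono l :: 'p mod_ring gpoly gseries) * coaction_mono r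
    = (if fst l \<inter> fst r = {} then (- 1) ^ crossings (fst l) (fst r) *
        coaction_mono (fst l \<union> fst r, snd l + snd r) else 0)"
proof -
  obtain A a B b where lr: "l = (A, a)" "r = (B, b)" by fastforce
  have "coaction_X A * coaction_Y a * (coaction_X B * coaction_Y b)
      = coaction_X A * coaction_X B * (coaction_Y a * coaction_Y b :: 'p mod_ring gpoly gseries)"
    unfolding mult.assoc[symmetric]
    unfolding mult.assoc[of _ "coaction_Y a"] coaction_Y_commute[of a "coaction_X B"]
    by (simp only: mult.assoc)
  then show ?thesis
    using assms by (simp add: lr coaction_mono_eq coaction_X_mult coaction_Y_mult
        minus_one_power_mult)
qed

lemma coaction_superset:
  assumes "finite K" "support u \<subseteq> K"
  shows "coaction u = (\<Sum>m\<in>K. cst (pcoeff u m) * coaction_mono m)"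
  unfolding coaction_def cst_def[symmetric]
  using assms by (intro sum.mono_neutral_left) (auto simp: support_def cst_zero)

lemma coaction_add: "coaction (u + v) = coaction u + coaction v"
proof -
  let ?K = "support u \<union> support v"
  have "support (u + v) \<subseteq> ?K" by (auto simp: support_def pcoeff_add)
  then show ?thesis
    by (simp add: coaction_superset[of ?K] finite_support pcoeff_add cst_add distrib_right
        sum.distrib)
qed

lemma coaction_zero: "coaction 0 = 0"
  using coaction_add[of 0 0] by simp

lemma coaction_sum: "coaction (sum f A) = (\<Sum>i\<in>A. coaction (f i))"
  by (induction A rule: infinite_finite_induct) (simp_all add: coaction_add coaction_zero)

lemma coaction_pterm:
  assumes "finite (fst m)"
  shows "coaction (pterm c m) = cst c * coaction_mono m"
proof -
  have "support (pterm c m) \<subseteq> {m}" by (auto simp: support_def pcoeff_pterm)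
  then show ?thesis using coaction_superset[of "{m}" "pterm c m"] assms by (simp add: pcoeff_pterm)
qed

theorem coaction_mult:
  fixes u v :: "'p :: prime_card mod_ring gpoly"
  assumes "odd CARD('p)"
  shows "coaction (u * v) = coaction u * coaction v"
proof -
  have "coaction (pterm c l * pterm d r) = coaction (pterm c l) * coaction (pterm d r)"
    if fin: "finite (fst l)" "finite (fst r)" for c d :: "'p mod_ring" and l r
  proof -
    have d: "(parity ^^ k) d = d" for k by (induction k) (simp_all add: parity_mod_ring_def)
    have "coaction (pterm c l) * coaction (pterm d r)
        = cst c * (coaction_mono l * cst d) * coaction_mono r"
      using fin by (simp add: coaction_pterm mult.assoc)
    also have "\<dots> = cst (c * d) * (coaction_mono l * coaction_mono r)"
      unfolding cst_commute[of d "coaction_mono l", symmetric] cst_mult mult.assoc ..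
    finally show ?thesis
      using fin assms
      by (simp add: coaction_mono_mult pterm_mult d coaction_pterm coaction_zero
          minus_one_power_mult cst_uminus)
  qed
  then have "coaction (\<Sum>l\<in>support u. \<Sum>r\<in>support v. pterm (pcoeff u l) l * pterm (pcoeff v r) r)
      = (\<Sum>l\<in>support u. \<Sum>r\<in>support v. coaction (pterm (pcoeff u l) l) * coaction (pterm (pcoeff v r) r))"
    by (simp add: coaction_sum finite_fst_support)
  then show ?thesis
    by (simp only: sum_product[symmetric] coaction_sum[symmetric] pterm_decomp[symmetric])
qed

theorem coaction_one: "coaction 1 = (1 :: 'p :: prime_card mod_ring gpoly gseries)"
proof -
  have "coaction_mono ({}, 0) = (1 :: 'p mod_ring gpoly gseries)" by (simp add: coaction_mono_def)
  then show ?thesis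
    using coaction_pterm[of "({}, 0)" "1 :: 'p mod_ring"] by (simp add: cst_one pterm_one)
qed

theorem coaction_xgen: "coaction (xgen i) = coaction_x i"
  by (simp add: xgen_def coaction_pterm cst_one coaction_mono_def)

theorem coaction_ygen: "coaction (ygen i) = coaction_y i"
  by (simp add: ygen_def coaction_pterm cst_one coaction_mono_def)

theorem gcoeff_coaction:
  assumes "\<And>m. m \<in> support u \<Longrightarrow> mdim m = d"
  shows "gcoeff (coaction u) (S, R) = (- 1) ^ (card S * (d + card S)) * milnor_op S R u"
proof -
  have "milnor_op S R u = (- 1) ^ (card S * (d + card S)) *
      gcoeff (coaction (\<Sum>m\<in>support u. pterm (pcoeff u m) m)) (S, R)"
    using assms by (simp add: milnor_op_def coaction_sum gcoeff_sum sum_distrib_left)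
  then show ?thesis
    by (simp only: pterm_decomp[symmetric]) (simp add: minus_one_power_mult)
qed


section \<open>The invariants lie in the cohomology of \<open>B(Z/p)^n\<close>\<close>

lemma cohomology_iff:
  "u \<in> cohomology n \<longleftrightarrow>
    (\<forall>S R. pcoeff u (S, R) \<noteq> 0 \<longrightarrow> S \<subseteq> {1..n} \<and> Poly_Mapping.keys R \<subseteq> {1..n})"
  by (auto simp: cohomology_def support_def)

lemma cohomology_zero: "0 \<in> cohomology n"
  by (simp add: cohomology_iff pcoeff_zero)

lemma cohomology_add: "u \<in> cohomology n \<Longrightarrow> v \<in> cohomology n \<Longrightarrow> u + v \<in> cohomology n"
  unfolding cohomology_iff pcoeff_add by (metis add_0)

lemma cohomology_sum: "(\<And>i. i \<in> A \<Longrightarrow> f i \<in> cohomology n) \<Longrightarrow> sum f A \<in> cohomology n"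
  by (induction A rule: infinite_finite_induct) (simp_all add: cohomology_zero cohomology_add)

lemma cohomology_pterm:
  "S \<subseteq> {1..n} \<Longrightarrow> Poly_Mapping.keys R \<subseteq> {1..n} \<Longrightarrow> pterm c (S, R) \<in> cohomology n"
  by (simp add: cohomology_iff pcoeff_pterm)

lemma cohomology_one: "(1 :: 'a :: supercomm_ring gpoly) \<in> cohomology n"
  using cohomology_pterm[of "{}" n 0 "1 :: 'a"] by (simp add: pterm_one)

lemma cohomology_mult:
  assumes "u \<in> cohomology n" "v \<in> cohomology n"
  shows "u * v \<in> cohomology n"
proof -
  have m: "fst m \<subseteq> {1..n} \<and> Poly_Mapping.keys (snd m) \<subseteq> {1..n}"
    if "w \<in> cohomology n" "m \<in> support w" for w :: "'a gpoly" and m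
    using that by (cases m) (auto simp: cohomology_iff support_def)
  have "pterm (pcoeff u l) l * pterm (pcoeff v r) r \<in> cohomology n"
    if "l \<in> support u" "r \<in> support v" for l r
  proof -
    have "fst l \<union> fst r \<subseteq> {1..n}" "Poly_Mapping.keys (snd l + snd r) \<subseteq> {1..n}"
      using m[OF assms(1) that(1)] m[OF assms(2) that(2)] keys_add[of "snd l" "snd r"] by blast+
    then show ?thesis
      using finite_fst_support[OF that(1)] finite_fst_support[OF that(2)]
      by (simp add: pterm_mult cohomology_zero cohomology_pterm del: Un_subset_iff)
  qed
  then have "(\<Sum>l\<in>support u. pterm (pcoeff u l) l) * (\<Sum>r\<in>support v. pterm (pcoeff v r) r)
      \<in> cohomology n"
    unfolding sum_product by (intro cohomology_sum)
  then show ?thesis by (simp only: pterm_decomp[symmetric])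
qed

lemma cohomology_prod_list:
  "(\<And>x. x \<in> set xs \<Longrightarrow> x \<in> cohomology n) \<Longrightarrow> prod_list xs \<in> cohomology n"
  by (induction xs) (simp_all add: cohomology_one cohomology_mult)

lemma cohomology_sign: "of_int (sign f) \<in> cohomology n"
proof (cases f rule: sign_cases)
  case odd
  have "pterm (- 1) ({}, 0) = - pterm (1 :: 'a) ({}, 0)"
    using pterm_add[of "1 :: 'a" "- 1" "({}, 0)"]
    by (simp add: eq_neg_iff_add_eq_0 pterm_zero add.commute)
  then show ?thesis using odd cohomology_pterm[of "{}" n 0 "- 1 :: 'a"] by (simp add: pterm_one)
qed (simp add: cohomology_one)

definition ypoly_in :: "nat \<Rightarrow> 'a :: zero ypoly \<Rightarrow> bool" where
  "ypoly_in n q \<longleftrightarrow> (\<forall>R\<in>Poly_Mapping.keys q. Poly_Mapping.keys R \<subseteq> {1..n})"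

lemma ypoly_in_add: "ypoly_in n p \<Longrightarrow> ypoly_in n q \<Longrightarrow> ypoly_in n (p + q)"
  using keys_add[of p q] by (auto simp: ypoly_in_def)

lemma ypoly_in_sum: "(\<And>i. i \<in> A \<Longrightarrow> ypoly_in n (f i)) \<Longrightarrow> ypoly_in n (sum f A)"
  by (induction A rule: infinite_finite_induct) (simp_all add: ypoly_in_add, simp_all add: ypoly_in_def)

lemma ypoly_in_mult: "ypoly_in n p \<Longrightarrow> ypoly_in n q \<Longrightarrow> ypoly_in n (p * q)"
  unfolding ypoly_in_def
proof (intro ballI)
  fix R
  assume "\<forall>R\<in>Poly_Mapping.keys p. Poly_Mapping.keys R \<subseteq> {1..n}"
    "\<forall>R\<in>Poly_Mapping.keys q. Poly_Mapping.keys R \<subseteq> {1..n}" "R \<in> Poly_Mapping.keys (p * q)"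
  moreover obtain a b where "R = a + b" "a \<in> Poly_Mapping.keys p" "b \<in> Poly_Mapping.keys q"
    using calculation(3) keys_mult[of p q] by blast
  ultimately show "Poly_Mapping.keys R \<subseteq> {1..n}" using keys_add[of a b] by blast
qed

lemma ypoly_in_one: "ypoly_in n 1"
  by (simp add: ypoly_in_def)

lemma ypoly_in_prod: "(\<And>i. i \<in> A \<Longrightarrow> ypoly_in n (f i)) \<Longrightarrow> ypoly_in n (prod f A)"
  for f :: "_ \<Rightarrow> 'a :: comm_ring_1 ypoly"
  by (induction A rule: infinite_finite_induct) (simp_all add: ypoly_in_mult ypoly_in_one)

lemma ypoly_in_power: "ypoly_in n p \<Longrightarrow> ypoly_in n (p ^ k)"
  by (induction k) (simp_all add: ypoly_in_mult ypoly_in_one)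

lemma ypoly_in_det:
  fixes f :: "nat \<Rightarrow> nat \<Rightarrow> 'a :: comm_ring_1 ypoly"
  assumes "\<And>u v. u < N \<Longrightarrow> v < N \<Longrightarrow> ypoly_in n (f u v)"
  shows "ypoly_in n (det (mat N N (\<lambda>(u, v). f u v)))"
proof -
  have "ypoly_in n (signof \<sigma> :: 'a ypoly)" for \<sigma> :: "nat \<Rightarrow> nat"
    by (cases \<sigma> rule: sign_cases) (simp_all add: ypoly_in_def)
  moreover have "mat N N (\<lambda>(u, v). f u v) $$ (i, \<sigma> i) = f i (\<sigma> i)" "\<sigma> i < N"
    if "\<sigma> permutes {0..<N}" "i \<in> {0..<N}" for \<sigma> i
    using that permutes_in_image[OF that(1), of i] by auto
  ultimately show ?thesis
    unfolding det_def
    by (auto intro!: ypoly_in_sum ypoly_in_mult ypoly_in_prod assms)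
qed

lemma ydet_in: "set is \<subseteq> {1..n} \<Longrightarrow> length is = length as \<Longrightarrow> ypoly_in n (ydet is as)"
  unfolding ydet_def
proof (intro ypoly_in_det ypoly_in_power)
  fix u
  assume "set is \<subseteq> {1..n}" "length is = length as" "u < length as"
  then have "is ! u \<in> {1..n}" by (metis nth_mem subset_iff)
  then show "ypoly_in n (yvar (is ! u))" by (simp add: ypoly_in_def yvar_def)
qed

theorem bracket_in_cohomology: "bracket k as \<in> cohomology (k + length as)"
proof -
  let ?n = "k + length as"
  have "of_int (sign (bracket_perm ?n I)) * prod_list (map xgen (sorted_list_of_set I)) *
      of_ypoly (ydet (sorted_list_of_set ({1..?n} - I)) as) \<in> (cohomology ?n :: 'a mod_ring gpoly set)"
    if I: "I \<subseteq> {1..?n}" "card I = k" for I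
  proof (intro cohomology_mult cohomology_sign cohomology_prod_list)
    have fin: "finite I" using I(1) by (rule finite_subset) simp
    show "x \<in> cohomology ?n" if "x \<in> set (map xgen (sorted_list_of_set I))"
      for x :: "'a mod_ring gpoly"
      using that fin I by (auto simp: xgen_def intro!: cohomology_pterm)
    have "ypoly_in ?n (ydet (sorted_list_of_set ({1..?n} - I)) as :: 'a mod_ring ypoly)"
      using I fin by (intro ydet_in) (auto simp: card_Diff_subset)
    then show "of_ypoly (ydet (sorted_list_of_set ({1..?n} - I)) as) \<in> (cohomology ?n :: 'a mod_ring gpoly set)"
      unfolding of_ypoly_def ypoly_in_def by (intro cohomology_sum cohomology_pterm) auto
  qed
  then show ?thesis unfolding bracket_def Let_def by (intro cohomology_sum) auto
qed

text \<open>For \<open>k = 0\<close> the bracket is the determinant \<open>[a_1, \<dots>, a_n]\<close>; in particular \<open>mui n [] = L_n\<close>.\<close>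

theorem bracket_0: "bracket 0 as = of_ypoly (ydet [1..<length as + 1] as)"
proof -
  let ?n = "length as"
  have s: "sorted_list_of_set {1..?n} = [1..<?n + 1]"
    by (metis Suc_eq_plus1 atLeastLessThanSuc_atLeastAtMost sorted_list_of_set_range)
  have "bracket_perm ?n {} j = id j" for j
    unfolding bracket_perm_def Diff_empty s by (auto simp del: upt_Suc)
  then have "bracket_perm ?n {} = id" by blast
  moreover have "{I. I \<subseteq> {1..?n} \<and> card I = 0} = {{}}"
    using finite_subset[of _ "{1..?n}"] by auto
  ultimately show ?thesis using s by (simp add: bracket_def del: upt_Suc)
qed

theorem mui_Nil: "mui n [] = of_ypoly (Ldet n n)"
proof -
  have "filter (\<lambda>j. j \<noteq> n) [0..<n + 1] = [0..<n]" by (auto simp: filter_id_conv)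
  then show ?thesis by (simp add: mui_def Ldet_def bracket_0)
qed

end

theory Submission
  imports Defs
begin

text \<open>
  The operation \<open>D = St^((r),(0))\<close> is an odd derivation with \<open>D x_i = y_i^(p^r)\<close> and \<open>D y_i = 0\<close>.
  Expanding determinants along a column gives
  \<open>D [k; a_(k+1), \<dots>, a_n] = (-1)^(k-1) [k-1; r, a_(k+1), \<dots>, a_n]\<close>. For a Mui invariant and \<open>r < n\<close> the
  new exponent either repeats one already present, so that the bracket vanishes, or fills the gap
  \<open>s_t\<close> after moving past the \<open>s_t - t + 1\<close> smaller exponents. For \<open>r = n\<close> the relation
  \<open>y_i^(p^n) = \<Sum>\<^sub>s (-1)^(n+s+1) Q_(n,s) y_i^(p^s)\<close>, whose sum is over \<open>s < n\<close>, reduces to the first case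
  by linearity in the new column.
\<close>

section \<open>The Frobenius relation for the Dickson invariants\<close>

text \<open>Adjoining a root \<open>z\<close> replaces an additive polynomial \<open>f\<close> by \<open>f(X)^p - f(z)^(p - 1) f(X)\<close>.\<close>

lemma frobenius_relation_exists:
  fixes x :: "nat \<Rightarrow> 'a :: comm_ring_1"
  assumes "prime CHAR('a)" and p: "p = CHAR('a)"
  shows "\<exists>c. \<forall>i\<in>{1..n}. x i ^ p ^ n = (\<Sum>s<n. c s * x i ^ p ^ s)"
proof (induction n)
  case (Suc n)
  then obtain c where c: "\<And>i. i \<in> {1..n} \<Longrightarrow> x i ^ p ^ n = (\<Sum>s<n. c s * x i ^ p ^ s)"
    by blast
  define f where "f z = z ^ p ^ n - (\<Sum>s<n. c s * z ^ p ^ s)" for z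
  define g where "g = f (x (Suc n)) ^ (p - 1)"
  \<comment> \<open>The enlarged additive polynomial is \<open>f ^ p - g * f\<close>, with leading
    term \<open>z ^ p ^ Suc n\<close>. The values \<open>d s\<close> are the negatives of its other
    coefficients: the terms \<open>c (s - 1) ^ p\<close> come from \<open>f ^ p\<close>, where
    Frobenius shifts the index by one, and the rest is \<open>g\<close> times the coefficients of
    \<open>f\<close>.\<close>
  define d where "d s = (if s = 0 then 0 else c (s - 1) ^ p) + g * (if s = n then 1 else - c s)" for s
  have p0: "p > 0" using assms prime_gt_0_nat by blast
  have frob: "f z ^ p = z ^ p ^ Suc n - (\<Sum>s<n. c s ^ p * z ^ p ^ Suc s)" for z
  proof -
    have "z ^ p ^ Suc n = (f z + (\<Sum>s<n. c s * z ^ p ^ s)) ^ p"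
      by (simp add: f_def mult.commute flip: power_mult)
    also have "\<dots> = f z ^ p + (\<Sum>s<n. (c s * z ^ p ^ s) ^ p)"
      unfolding freshmans_dream[OF assms] freshmans_dream_sum[OF assms] ..
    also have "(\<Sum>s<n. (c s * z ^ p ^ s) ^ p) = (\<Sum>s<n. c s ^ p * z ^ p ^ Suc s)"
      by (simp add: power_mult_distrib mult.commute flip: power_mult)
    finally show ?thesis by simp
  qed
  \<comment> \<open>At the new element this is the choice of \<open>g\<close>; at the earlier ones
    \<open>f\<close> vanishes by the induction hypothesis.\<close>
  have root: "f (x i) ^ p = g * f (x i)" if "i \<in> {1..Suc n}" for i
  proof (cases "i = Suc n")
    case True
    then show ?thesis using p0 unfolding g_def by (simp add: power_eq_if)
  next
    case False
    then have "f (x i) = 0" using that c[of i] by (simp add: f_def)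
    then show ?thesis using p0 by (simp add: power_0_left)
  qed
  have d: "(\<Sum>s<Suc n. d s * z ^ p ^ s) = (\<Sum>s<n. c s ^ p * z ^ p ^ Suc s) + g * f z" for z
  proof -
    have "(\<Sum>s<Suc n. d s * z ^ p ^ s)
        = (\<Sum>s<Suc n. (if s = 0 then 0 else c (s - 1) ^ p) * z ^ p ^ s)
        + g * (\<Sum>s<Suc n. (if s = n then 1 else - c s) * z ^ p ^ s)"
      unfolding d_def by (simp only: distrib_right sum.distrib sum_distrib_left mult.assoc)
    also have "(\<Sum>s<Suc n. (if s = n then 1 else - c s) * z ^ p ^ s) = f z"
      by (simp add: f_def sum_negf)
    also have "(\<Sum>s<Suc n. (if s = 0 then 0 else c (s - 1) ^ p) * z ^ p ^ s)
        = (\<Sum>s<n. c s ^ p * z ^ p ^ Suc s)"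
      by (subst sum.lessThan_Suc_shift) simp
    finally show ?thesis .
  qed
  have "x i ^ p ^ Suc n = (\<Sum>s<Suc n. d s * x i ^ p ^ s)" if "i \<in> {1..Suc n}" for i
    unfolding d root[OF that, symmetric] frob by simp
  then show ?case by blast
qed simp

text \<open>Supplies the prime characteristic that the freshman's dream requires for polynomials in
  the y_i.\<close>

lemma CHAR_ypoly: "CHAR('p :: prime_card mod_ring ypoly) = CARD('p)"
proof -
  have "of_nat CARD('p) = (0 :: 'p mod_ring ypoly)"
    by (simp flip: single_of_nat)
  then have "CHAR('p mod_ring ypoly) dvd CARD('p)"
    by (simp only: of_nat_eq_0_iff_char_dvd)
  then show ?thesis
    using prime_card[where 'a = 'p] CHAR_not_1[where 'a = "'p mod_ring ypoly"]
    by (auto simp: prime_nat_iff)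
qed

section \<open>Expansion and column rules for the determinants \<open>ydet\<close>\<close>

lemma ydet_expand_list:
  assumes "length is = Suc (length as + length bs)"
  shows "(ydet is (as @ r # bs) :: 'p :: prime_card mod_ring ypoly)
    = (\<Sum>u<length is. (- 1) ^ (u + length as) * yvar (is ! u) ^ (CARD('p) ^ r) *
        ydet (take u is @ drop (Suc u) is) (as @ bs))"
proof -
  define N where "N = length is"
  define A :: "'p mod_ring ypoly mat" where
    "A = mat N N (\<lambda>(u, v). yvar (is ! u) ^ (CARD('p) ^ ((as @ r # bs) ! v)))"
  have "ydet is (as @ r # bs) = det A" using assms by (simp add: ydet_def A_def N_def)
  also have "\<dots> = (\<Sum>u<N. A $$ (u, length as) * cofactor A u (length as))"
    by (rule laplace_expansion_column) (use assms in \<open>auto simp: A_def N_def\<close>)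
  also have "\<dots> = (\<Sum>u<N. (- 1) ^ (u + length as) * yvar (is ! u) ^ (CARD('p) ^ r) *
        ydet (take u is @ drop (Suc u) is) (as @ bs))"
  proof (intro sum.cong refl)
    fix u assume "u \<in> {..<N}"
    then have u: "u < N" by simp
    \<comment> \<open>Deleting a row and a column shifts the later indices by one, which is the
      effect of dropping entry \<open>u\<close> from \<open>is\<close> and the exponent
      \<open>r\<close> from the column list.\<close>
    have "mat_delete A u (length as) = mat (length (as @ bs)) (length (as @ bs))
        (\<lambda>(i, v). yvar ((take u is @ drop (Suc u) is) ! i) ^ (CARD('p) ^ ((as @ bs) ! v)))"
      unfolding mat_delete_def using assms u
      by (intro eq_matI) (auto simp: A_def N_def nth_append not_less_eq min_def)
    then show "A $$ (u, length as) * cofactor A u (length as)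
        = (- 1) ^ (u + length as) * yvar (is ! u) ^ (CARD('p) ^ r) *
          ydet (take u is @ drop (Suc u) is) (as @ bs)"
      using assms u by (simp add: cofactor_def ydet_def A_def N_def mult_ac)
  qed
  finally show ?thesis by (simp add: N_def)
qed

text \<open>Converts the position of a row into a count of smaller elements, so that expansions can
  be indexed by elements of \<open>K\<close> instead of positions.\<close>

lemma card_less_nth_sorted_list_of_set:
  assumes "finite K" "u < card K"
  shows "card {j \<in> K. j < sorted_list_of_set K ! u} = u"
proof -
  let ?xs = "sorted_list_of_set K"
  have len: "length ?xs = card K" by simp
  have nth: "?xs ! v < ?xs ! w \<longleftrightarrow> v < w" if "v < card K" "w < card K" for v w
    using that len strict_sorted_list_of_set[of K] linorder_less_linear[of v w]
    by (metis order_less_asym sorted_wrt_nth_less less_irrefl)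
  have "{j \<in> K. j < ?xs ! u} = (!) ?xs ` {..<u}"
  proof (intro equalityI subsetI)
    fix j assume j: "j \<in> {j \<in> K. j < ?xs ! u}"
    then have "j \<in> set ?xs" using assms by simp
    then obtain v where "v < card K" "j = ?xs ! v" by (metis in_set_conv_nth len)
    then show "j \<in> (!) ?xs ` {..<u}" using j nth[of v u] assms by auto
  next
    fix j assume "j \<in> (!) ?xs ` {..<u}"
    then obtain v where v: "v < u" "j = ?xs ! v" by blast
    then have "j \<in> set ?xs" using len assms by (metis nth_mem less_trans)
    then show "j \<in> {j \<in> K. j < ?xs ! u}" using v nth[of v u] assms by simp
  qed
  moreover have "inj_on ((!) ?xs) {..<u}"
    using assms len by (intro inj_on_nth) auto
  ultimately show ?thesis by (simp add: card_image)
qed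

text \<open>The Laplace sign is put in terms of smaller elements of \<open>K\<close>, the form in
  which it can be compared with crossing numbers; the minors are again determinants on sorted
  sets.\<close>

lemma ydet_expand:
  assumes "finite K" "card K = Suc (length as + length bs)"
  shows "(ydet (sorted_list_of_set K) (as @ r # bs) :: 'p :: prime_card mod_ring ypoly)
    = (\<Sum>i\<in>K. (- 1) ^ (card {j \<in> K. j < i} + length as) * yvar i ^ (CARD('p) ^ r) *
        ydet (sorted_list_of_set (K - {i})) (as @ bs))"
proof -
  let ?xs = "sorted_list_of_set K"
  have len: "length ?xs = card K" by simp
  have bij: "bij_betw ((!) ?xs) {..<card K} K"
    using assms by (intro bij_betw_nth) auto
  have del: "take u ?xs @ drop (Suc u) ?xs = sorted_list_of_set (K - {?xs ! u})"
    if "u < card K" for u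
  proof -
    have split: "?xs = take u ?xs @ ?xs ! u # drop (Suc u) ?xs"
      using that len by (metis id_take_nth_drop)
    have "?xs ! u \<notin> set (take u ?xs)"
      using distinct_sorted_list_of_set[of K] by (subst (asm) split) auto
    then have "remove1 (?xs ! u) ?xs = take u ?xs @ drop (Suc u) ?xs"
      by (subst (2) split) (simp add: remove1_append)
    then show ?thesis using assms by (simp add: sorted_list_of_set_remove)
  qed
  have "(ydet ?xs (as @ r # bs) :: 'p mod_ring ypoly)
    = (\<Sum>u<card K. (- 1) ^ (u + length as) * yvar (?xs ! u) ^ (CARD('p) ^ r) *
        ydet (take u ?xs @ drop (Suc u) ?xs) (as @ bs))"
    using ydet_expand_list[of ?xs as bs r] assms by simp
  also have "\<dots> = (\<Sum>u<card K. (- 1) ^ (card {j \<in> K. j < ?xs ! u} + length as) *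
        yvar (?xs ! u) ^ (CARD('p) ^ r) * ydet (sorted_list_of_set (K - {?xs ! u})) (as @ bs))"
    using assms del by (intro sum.cong refl) (simp add: card_less_nth_sorted_list_of_set)
  also have "\<dots> = (\<Sum>i\<in>K. (- 1) ^ (card {j \<in> K. j < i} + length as) *
        yvar i ^ (CARD('p) ^ r) * ydet (sorted_list_of_set (K - {i})) (as @ bs))"
    by (rule sum.reindex_bij_betw[OF bij])
  finally show ?thesis .
qed

text \<open>Expanded along the column with exponent \<open>r\<close>, both determinants have the
  same minors; the positions of that column differ by \<open>length as\<close>.\<close>

lemma ydet_move:
  assumes "finite K" "card K = Suc (length as + length bs)"
  shows "(ydet (sorted_list_of_set K) (as @ r # bs) :: 'p :: prime_card mod_ring ypoly)
    = (- 1) ^ length as * ydet (sorted_list_of_set K) (r # as @ bs)"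
  using ydet_expand[OF assms, of r, where 'p = 'p]
    ydet_expand[of K "[]" "as @ bs" r, where 'p = 'p] assms
  by (simp add: power_add sum_distrib_left mult_ac)

lemma ydet_repeat:
  assumes "r \<in> set as"
  shows "ydet is (r # as) = 0"
proof -
  obtain v where v: "v < length as" "as ! v = r" using assms by (metis in_set_conv_nth)
  show ?thesis
    unfolding ydet_def
    by (rule det_identical_columns[where n = "Suc (length as)" and i = 0 and j = "Suc v"])
       (use v in \<open>auto simp: col_def intro!: eq_vecI\<close>)
qed

text \<open>The minors of the first column do not involve \<open>r\<close>, so a relation with
  coefficients independent of the row passes from the entries to the determinant.\<close>

lemma ydet_linear:
  assumes "finite K" "card K = Suc (length as)" "finite T"
    and "\<And>i. i \<in> K \<Longrightarrow> yvar i ^ (CARD('p) ^ r) = (\<Sum>t\<in>T. c t * yvar i ^ (CARD('p) ^ t))"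
  shows "(ydet (sorted_list_of_set K) (r # as) :: 'p :: prime_card mod_ring ypoly)
    = (\<Sum>t\<in>T. c t * ydet (sorted_list_of_set K) (t # as))"
proof -
  have e: "(ydet (sorted_list_of_set K) (t # as) :: 'p mod_ring ypoly)
    = (\<Sum>i\<in>K. (- 1) ^ card {j \<in> K. j < i} * yvar i ^ (CARD('p) ^ t) *
        ydet (sorted_list_of_set (K - {i})) as)" for t
    using ydet_expand[of K "[]" as t] assms(1,2) by simp
  show ?thesis
    unfolding e sum_distrib_left
    by (subst sum.swap) (simp add: assms(4) sum_distrib_left sum_distrib_right mult_ac)
qed

lemma upt_eq_sorted_list_of_set: "[1..<n + 1] = sorted_list_of_set {1..n}"
  by (metis Suc_eq_plus1 atLeastLessThanSuc_atLeastAtMost sorted_list_of_set_range)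

section \<open>Nonvanishing of \<open>L_n\<close> and uniqueness of the Dickson quotients\<close>

lemma prod_single:
  "(\<Prod>i\<in>A. Poly_Mapping.single (f i) (1 :: 'a :: comm_ring_1)) = Poly_Mapping.single (\<Sum>i\<in>A. f i :: nat \<Rightarrow>\<^sub>0 nat) 1"
  by (induction A rule: infinite_finite_induct) (simp_all add: mult_single)

lemma yvar_power: "(yvar i :: 'a :: comm_ring_1 ypoly) ^ k = Poly_Mapping.single (Poly_Mapping.single i k) 1"
  unfolding yvar_def by (induction k) (simp_all add: mult_single flip: single_add)

text \<open>Distinct permutations contribute distinct monomials to the Leibniz formula, because
  \<open>CARD('p) > 1\<close> makes the powers distinct. Hence the diagonal monomial has coefficient
  1.\<close>

lemma Ldet_nonzero: "(Ldet n n :: 'p :: prime_card mod_ring ypoly) \<noteq> 0"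
proof -
  let ?q = "CARD('p)"
  \<comment> \<open>The exponent vector of the summand of \<open>\<sigma>\<close>; rows are counted
    from 0 and variables from 1.\<close>
  define e where "e \<sigma> = (\<Sum>u<n. Poly_Mapping.single (Suc u) (?q ^ \<sigma> u))" for \<sigma> :: "nat \<Rightarrow> nat"
  have q: "?q > 1" using prime_card[where 'a = 'p] prime_gt_1_nat by blast
  have e: "Poly_Mapping.lookup (e \<sigma>) (Suc u) = ?q ^ \<sigma> u" if "u < n" for \<sigma> u
    unfolding e_def lookup_sum using that by (simp add: lookup_single when_def)
  have "filter (\<lambda>j. j \<noteq> n) [0..<n + 1] = [0..<n]" by (auto simp: filter_id_conv)
  then have "(Ldet n n :: 'p mod_ring ypoly)
      = det (mat n n (\<lambda>(u, v). yvar (Suc u) ^ (?q ^ v)))"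
    unfolding Ldet_def ydet_def
    by (intro arg_cong[where f = det] eq_matI) (auto simp del: upt_Suc)
  also have "\<dots> = (\<Sum>\<sigma> | \<sigma> permutes {0..<n}. signof \<sigma> * (\<Prod>u = 0..<n. yvar (Suc u) ^ (?q ^ \<sigma> u)))"
    unfolding det_def using permutes_in_image
    by (auto intro!: sum.cong arg_cong2[where f = "(*)"] prod.cong simp: permutes_in_image)
  also have "\<dots> = (\<Sum>\<sigma> | \<sigma> permutes {0..<n}. Poly_Mapping.single (e \<sigma>) (signof \<sigma>))"
    unfolding yvar_power prod_single e_def atLeast0LessThan
    by (intro sum.cong refl) (auto simp: sign_def single_uminus)
  finally have "Poly_Mapping.lookup (Ldet n n :: 'p mod_ring ypoly) (e id)
      = (\<Sum>\<sigma> | \<sigma> permutes {0..<n}. if e \<sigma> = e id then signof \<sigma> else 0)"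
    by (simp add: lookup_sum lookup_single when_def)
  also have "\<dots> = (\<Sum>\<sigma> | \<sigma> permutes {0..<n}. if \<sigma> = id then signof \<sigma> else 0)"
  proof (intro sum.cong refl if_cong)
    fix \<sigma> assume "\<sigma> \<in> {\<sigma>. \<sigma> permutes {0..<n}}"
    then have \<sigma>: "\<sigma> permutes {0..<n}" by simp
    have "\<sigma> u = u" if "e \<sigma> = e id" for u
    proof (cases "u < n")
      case True
      then have "?q ^ \<sigma> u = ?q ^ u" using e[OF True, of \<sigma>] e[OF True, of id] that by simp
      then show ?thesis using q power_inject_exp by blast
    next
      case False
      then show ?thesis using permutes_not_in[OF \<sigma>] by simp
    qed
    then show "e \<sigma> = e id \<longleftrightarrow> \<sigma> = id" by auto
  qed
  also have "\<dots> = 1" by (simp add: permutes_id finite_permutations)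
  finally show ?thesis by auto
qed

lemma upt_split: "s < n \<Longrightarrow> [0..<n] = [0..<s] @ s # [Suc s..<n]"
  using upt_add_eq_append[of 0 s "n - s"] by (simp add: upt_conv_Cons)

lemma filter_neq_upt: "s < n \<Longrightarrow> filter (\<lambda>j. j \<noteq> s) [0..<n] = [0..<s] @ [Suc s..<n]"
  by (subst upt_split[of s n]) (simp_all add: filter_id_conv)

text \<open>Uniqueness in the definite description is cancellation of the nonzero
  \<open>L_n\<close>, so any explicit quotient identifies \<open>dickson\<close>.\<close>

lemma dickson_eq:
  assumes "q * Ldet n n = (Ldet n s :: 'p :: prime_card mod_ring ypoly)"
  shows "dickson n s = q"
  unfolding dickson_def
  proof (rule the_equality)
  fix q' :: "'p mod_ring ypoly" assume "q' * Ldet n n = Ldet n s"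
  then have "q' * Ldet n n = q * Ldet n n" by (simp only: assms)
  then show "q' = q" using Ldet_nonzero[where 'p = 'p] by (simp only: mult_cancel_right) simp
qed (rule assms)

text \<open>By Cramer's rule the coefficients of any relation expressing \<open>y_i^(p^n)\<close> through the lower
  Frobenius powers, uniformly in \<open>i\<close>, are the Dickson invariants up to sign; this also shows that
  the quotient defining them exists.\<close>

lemma dickson_relation:
  assumes "i \<in> {1..n}"
  shows "(yvar i :: 'p :: prime_card mod_ring ypoly) ^ (CARD('p) ^ n)
    = (\<Sum>s<n. (- 1) ^ (n + s + 1) * dickson n s * yvar i ^ (CARD('p) ^ s))"
proof -
  let ?K = "{1..n}"
  obtain c :: "nat \<Rightarrow> 'p mod_ring ypoly" where
    c: "\<And>i. i \<in> ?K \<Longrightarrow> yvar i ^ CARD('p) ^ n = (\<Sum>s<n. c s * yvar i ^ CARD('p) ^ s)"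
    using frobenius_relation_exists[where 'a = "'p mod_ring ypoly", OF _ refl, of n yvar]
    unfolding CHAR_ypoly using prime_card[where 'a = 'p] by blast
  have "dickson n s = (- 1) ^ (n + s + 1) * c s" if s: "s < n" for s
  proof (rule dickson_eq)
    let ?B = "[0..<s] @ [Suc s..<n]"
    have L: "(Ldet n n :: 'p mod_ring ypoly) = ydet (sorted_list_of_set ?K) [0..<n]"
      unfolding Ldet_def upt_eq_sorted_list_of_set by (simp add: filter_id_conv)
    note n = upt_split[OF s]
    have len: "card ?K = Suc (length ?B)" using s by simp
    \<comment> \<open>Cramer's rule: the last column, with exponent \<open>n\<close>, is moved to
      the front past the other \<open>n - 1\<close> columns, and there the relation is
      substituted.\<close>
    have "(Ldet n s :: 'p mod_ring ypoly) = ydet (sorted_list_of_set ?K) (?B @ n # [])"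
      unfolding Ldet_def upt_eq_sorted_list_of_set
      using s by (simp add: filter_neq_upt)
    also have "\<dots> = (- 1) ^ (n - 1) * ydet (sorted_list_of_set ?K) (n # ?B)"
      using s len by (subst ydet_move) auto
    also have "ydet (sorted_list_of_set ?K) (n # ?B)
        = (\<Sum>t<n. c t * ydet (sorted_list_of_set ?K) (t # ?B))"
      by (rule ydet_linear) (use len c in auto)
    \<comment> \<open>Every \<open>t < n\<close> other than \<open>s\<close> already occurs in
      \<open>?B\<close> and gives a repeated column.\<close>
    also have "\<dots> = (\<Sum>t\<in>{s}. c t * ydet (sorted_list_of_set ?K) (t # ?B))"
      by (rule sum.mono_neutral_right) (use s in \<open>auto intro!: ydet_repeat\<close>)
    also have "\<dots> = c s * ((- 1) ^ s * ydet (sorted_list_of_set ?K) [0..<n])"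
      unfolding n using len by (subst ydet_move) (auto simp: minus_one_power_mult)
    finally show "(- 1) ^ (n + s + 1) * c s * Ldet n n = Ldet n s"
      using s by (auto simp: L minus_one_power_mult)
  qed
  then show ?thesis
    using c[OF assms] by (auto intro!: sum.cong simp: minus_one_power_mult)
qed

section \<open>Signs of the bracket permutations\<close>

text \<open>Secures that the sign is multiplicative on these maps. The sorted listing is a bijection
  from positions counted from 0, and the shift \<open>j - 1\<close> adapts it to indices counted
  from 1.\<close>

lemma bracket_perm_permutes:
  assumes "I \<subseteq> {1..n}"
  shows "bracket_perm n I permutes {1..n}"
proof -
  let ?xs = "sorted_list_of_set I @ sorted_list_of_set ({1..n} - I)"
  have fin: "finite I" using assms by (rule finite_subset) simp
  have dist: "distinct ?xs" and set: "set ?xs = {1..n}" using fin assms by auto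
  then have len: "length ?xs = n" by (metis card_atLeastAtMost diff_Suc_1 distinct_card)
  have "bij_betw (\<lambda>j. j - 1) {1..n} {..<n}"
    by (rule bij_betw_byWitness[where f' = Suc]) auto
  moreover have "bij_betw ((!) ?xs) {..<n} {1..n}"
    using dist len set by (intro bij_betw_nth) auto
  ultimately have "bij_betw ((!) ?xs \<circ> (\<lambda>j. j - 1)) {1..n} {1..n}"
    by (rule bij_betw_trans)
  then have "bij_betw (bracket_perm n I) {1..n} {1..n}"
    by (rule bij_betw_cong[THEN iffD1, rotated]) (simp add: bracket_perm_def)
  then show ?thesis by (rule bij_imp_permutes) (simp add: bracket_perm_def del: atLeastAtMost_iff)
qed

text \<open>Both lists are strictly increasing with the same elements. It serves to carry sorted
  lists through a transposition that preserves order on the set in question.\<close>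

lemma sorted_list_of_set_strict_mono_image:
  assumes "finite A" "strict_mono_on A f"
  shows "sorted_list_of_set (f ` A) = map f (sorted_list_of_set A)"
proof -
  have "sorted_wrt (\<lambda>x y. f x < f y) (sorted_list_of_set A)"
    by (rule sorted_wrt_mono_rel[OF _ strict_sorted_list_of_set])
       (use assms in \<open>auto simp: strict_mono_on_def\<close>)
  then have "sorted_wrt (<) (map f (sorted_list_of_set A))" by (simp add: sorted_wrt_map)
  then show ?thesis
    using assms(1) by (intro strict_sorted_equal) auto
qed

text \<open>Neither \<open>I\<close> nor its complement contains both \<open>i\<close> and
  \<open>Suc i\<close>, so the transposition is strictly monotone on each and commutes with listing
  them in order.\<close>

lemma bracket_perm_transpose:
  assumes "I \<subseteq> {1..n}" "Suc i \<in> I" "i \<notin> I" "i \<ge> 1"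
  shows "bracket_perm n (transpose i (Suc i) ` I) = transpose i (Suc i) \<circ> bracket_perm n I"
proof -
  let ?\<tau> = "transpose i (Suc i)"
  have fin: "finite I" using assms(1) by (rule finite_subset) simp
  have i: "i \<in> {1..n}" "Suc i \<in> {1..n}" using assms by auto
  have \<tau>K: "?\<tau> ` {1..n} = {1..n}" by (rule permutes_image[OF permutes_swap_id[OF i]])
  have "strict_mono_on I ?\<tau>" "strict_mono_on ({1..n} - I) ?\<tau>"
    using assms by (auto simp: strict_mono_on_def transpose_def)
  moreover have "{1..n} - ?\<tau> ` I = ?\<tau> ` ({1..n} - I)"
    using image_set_diff[of ?\<tau> "{1..n}" I] \<tau>K by simp
  ultimately have xs: "sorted_list_of_set (?\<tau> ` I) @ sorted_list_of_set ({1..n} - ?\<tau> ` I)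
      = map ?\<tau> (sorted_list_of_set I @ sorted_list_of_set ({1..n} - I))"
    using fin by (simp add: sorted_list_of_set_strict_mono_image)
  have len: "length (sorted_list_of_set I @ sorted_list_of_set ({1..n} - I)) = n"
    using fin assms(1) card_mono[of "{1..n}" I] by (simp add: card_Diff_subset)
  show ?thesis
  proof
    fix j
    show "bracket_perm n (?\<tau> ` I) j = (?\<tau> \<circ> bracket_perm n I) j"
    proof (cases "j \<in> {1..n}")
      case True
      then have "j - 1 < n" by auto
      then show ?thesis using True len unfolding bracket_perm_def xs by (simp del: map_append)
    next
      case False
      then have "j \<noteq> i" "j \<noteq> Suc i" using i by auto
      then show ?thesis using False by (simp add: bracket_perm_def del: atLeastAtMost_iff)
    qed
  qed
qed

text \<open>Exchanging adjacent values preserves the order of every pair except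
  \<open>(Suc i, i)\<close>, so it matches the remaining crossings of \<open>I\<close> with those of
  its image.\<close>

lemma crossings_transpose:
  assumes "I \<subseteq> {1..n}" "Suc i \<in> I" "i \<notin> I" "i \<ge> 1"
  shows "crossings I ({1..n} - I)
    = Suc (crossings (transpose i (Suc i) ` I) ({1..n} - transpose i (Suc i) ` I))"
proof -
  let ?\<tau> = "transpose i (Suc i)"
  let ?P = "\<lambda>I. {(a, b). a \<in> I \<and> b \<in> {1..n} - I \<and> b < a}"
  have i: "i \<in> {1..n}" "Suc i \<in> {1..n}" using assms by auto
  have \<tau>K: "?\<tau> j \<in> {1..n} \<longleftrightarrow> j \<in> {1..n}" for j
    by (rule permutes_in_image[OF permutes_swap_id[OF i]])
  have mem: "j \<in> ?\<tau> ` I \<longleftrightarrow> ?\<tau> j \<in> I" for j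
    by (metis image_iff transpose_involutory)
  have less: "?\<tau> b < ?\<tau> a" if "b < a" "(a, b) \<noteq> (Suc i, i)" for a b
    using that by (auto simp: transpose_def)
  have eq: "?P I = insert (Suc i, i) (map_prod ?\<tau> ?\<tau> ` ?P (?\<tau> ` I))" (is "_ = insert _ ?Q")
  proof (intro equalityI subsetI)
    fix z assume z: "z \<in> ?P I"
    show "z \<in> insert (Suc i, i) ?Q"
    proof (cases "z = (Suc i, i)")
      case False
      then have "map_prod ?\<tau> ?\<tau> z \<in> ?P (?\<tau> ` I)"
        using z less by (auto simp: mem \<tau>K simp del: atLeastAtMost_iff One_nat_def)
      moreover have "z = map_prod ?\<tau> ?\<tau> (map_prod ?\<tau> ?\<tau> z)" by (cases z) simp
      ultimately show ?thesis by (intro insertI2 image_eqI)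
    qed simp
  next
    fix z assume "z \<in> insert (Suc i, i) ?Q"
    moreover have "(Suc i, i) \<in> ?P I" using assms i by auto
    moreover have "?Q \<subseteq> ?P I"
    proof (intro subsetI)
      fix z assume "z \<in> ?Q"
      then obtain a b where z: "z = (?\<tau> a, ?\<tau> b)" "?\<tau> a \<in> I" "b \<in> {1..n}" "?\<tau> b \<notin> I" "b < a"
        by (auto simp: mem simp del: atLeastAtMost_iff)
      moreover have "(a, b) \<noteq> (Suc i, i)" using z assms by auto
      ultimately show "z \<in> ?P I" using less[of b a] \<tau>K[of b] by blast
    qed
    ultimately show "z \<in> ?P I" by blast
  qed
  have fin: "finite (?P J)" if "J \<subseteq> {1..n}" for J
    by (rule finite_subset[of _ "{1..n} \<times> {1..n}"]) (use that in auto)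
  have \<tau>I: "?\<tau> ` I \<subseteq> {1..n}" using assms(1) \<tau>K by (auto simp del: atLeastAtMost_iff One_nat_def)
  have "(Suc i, i) \<notin> ?Q"
    by (auto simp: transpose_eq_iff)
  moreover have "inj_on (map_prod ?\<tau> ?\<tau>) A" for A
    by (auto simp: inj_on_def transpose_eq_iff)
  ultimately have "card (?P I) = Suc (card (?P (?\<tau> ` I)))"
    unfolding eq using fin[OF \<tau>I] by (simp add: card_image)
  then show ?thesis by (simp add: crossings_def)
qed

text \<open>Induction on the number of crossings: if \<open>i + 1 \<in> I\<close> but \<open>i \<notin> I\<close>, exchanging the two values removes
  exactly one crossing and keeps the order within \<open>I\<close> and within its complement.\<close>

lemma sign_bracket_perm:
  assumes "I \<subseteq> {1..n}"
  shows "sign (bracket_perm n I) = (- 1) ^ crossings I ({1..n} - I)"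
  using assms
proof (induction "crossings I ({1..n} - I)" arbitrary: I)
  case 0
  have fin: "finite I" using 0(2) by (rule finite_subset) simp
  have "finite {(a, b). a \<in> I \<and> b \<in> {1..n} - I \<and> b < a}"
    by (rule finite_subset[of _ "{1..n} \<times> {1..n}"]) (use 0(2) in auto)
  then have "{(a, b). a \<in> I \<and> b \<in> {1..n} - I \<and> b < a} = {}"
    using 0(1) by (simp add: crossings_def)
  then have less: "a < b" if "a \<in> I" "b \<in> {1..n} - I" for a b
    using that by (metis (mono_tags, lifting) DiffD2 case_prodI empty_iff linorder_neqE_nat mem_Collect_eq)
  \<comment> \<open>Without crossings all of \<open>I\<close> precedes its complement, so the
    concatenated listing is already increasing and the permutation is the identity.\<close>
  have "sorted_list_of_set I @ sorted_list_of_set ({1..n} - I) = sorted_list_of_set {1..n}"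
    by (rule strict_sorted_equal) (use less fin 0(2) in \<open>auto simp: sorted_wrt_append\<close>)
  then have "bracket_perm n I = id"
    unfolding bracket_perm_def
    by (auto simp flip: atLeastLessThanSuc_atLeastAtMost simp del: upt_Suc)
  then show ?case by (simp only: 0(1)[symmetric] sign_id power_0)
next
  case (Suc c)
  have fin: "finite I" using Suc(3) by (rule finite_subset) simp
  have "{(a, b). a \<in> I \<and> b \<in> {1..n} - I \<and> b < a} \<noteq> {}"
    using Suc(2) unfolding crossings_def by (metis card.empty nat.distinct(1))
  then obtain a b where ab: "a \<in> I" "b \<in> {1..n}" "b \<notin> I" "b < a" by auto
  \<comment> \<open>Take the least element of \<open>I\<close> above the missing value
    \<open>b\<close>. Its predecessor is \<open>b\<close> itself or lies strictly between
    \<open>b\<close> and \<open>k\<close>, hence is not in \<open>I\<close>; this is the adjacent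
    pair to exchange.\<close>
  define k where "k = (LEAST a. a \<in> I \<and> b < a)"
  have k: "k \<in> I" "b < k" using LeastI[of "\<lambda>a. a \<in> I \<and> b < a" a] ab by (auto simp: k_def)
  have "k - 1 \<notin> I"
    using not_less_Least[of "k - 1" "\<lambda>a. a \<in> I \<and> b < a"] k ab
    unfolding k_def[symmetric] by (cases "k - 1 = b") auto
  then obtain i where i: "Suc i \<in> I" "i \<notin> I" "i \<ge> 1"
    using k ab by (cases k) auto
  let ?J = "transpose i (Suc i) ` I"
  have J: "?J \<subseteq> {1..n}"
    using Suc(3) permutes_image[OF permutes_swap_id[of i "{1..n}" "Suc i"]] i by fastforce
  have "c = crossings ?J ({1..n} - ?J)"
    using crossings_transpose[OF Suc(3) i] Suc(2) by simp
  from Suc(1)[OF this J] have "sign (bracket_perm n ?J) = (- 1) ^ c"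
    using \<open>c = _\<close> by simp
  moreover have "sign (bracket_perm n ?J) = - sign (bracket_perm n I)"
  proof -
    have "permutation (bracket_perm n I)"
      using bracket_perm_permutes[OF Suc(3)] by (auto simp: permutation_permutes)
    then show ?thesis
      unfolding bracket_perm_transpose[OF Suc(3) i]
      by (simp add: sign_compose permutation_swap_id sign_swap_id)
  qed
  ultimately show ?case by (simp only: Suc(2)[symmetric] power_Suc)
qed

section \<open>The operation dual to \<open>\<tau>_r\<close> on monomials\<close>

text \<open>The product x_I q. Keeping the even part as a commutative polynomial lets determinant
  identities be applied inside each summand of a bracket.\<close>

definition xterm :: "nat set \<Rightarrow> 'a :: supercomm_ring ypoly \<Rightarrow> 'a gpoly" where
  "xterm I q = (\<Sum>R\<in>Poly_Mapping.keys q. pterm (Poly_Mapping.lookup q R) (I, R))"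

lemma pcoeff_xterm:
  "pcoeff (xterm I q) (S, R) = (if S = I \<and> finite I then Poly_Mapping.lookup q R else 0)"
proof -
  have "pcoeff (xterm I q) (S, R)
      = (\<Sum>R'\<in>Poly_Mapping.keys q. if R' = R then
          (if S = I \<and> finite I then Poly_Mapping.lookup q R else 0) else 0)"
    unfolding xterm_def pcoeff_sum by (intro sum.cong refl) (auto simp: pcoeff_pterm)
  then show ?thesis by (auto simp: in_keys_iff)
qed

lemma pcoeff_uminus: "pcoeff (- u) m = - pcoeff u m"
  by (simp add: pcoeff_def uminus_gpoly.rep_eq uminus_gseries.rep_eq)

lemma xterm_add: "xterm I (p + q) = xterm I p + xterm I q"
  by (rule gpoly_eqI) (auto simp: pcoeff_xterm pcoeff_add lookup_add)

lemma xterm_zero: "xterm I 0 = 0"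
  by (simp add: xterm_def)

lemma xterm_uminus: "xterm I (- q) = - xterm I q"
  by (rule gpoly_eqI) (auto simp: pcoeff_xterm pcoeff_uminus)

lemma xterm_sum: "xterm I (sum f A) = (\<Sum>a\<in>A. xterm I (f a))"
  by (induction A rule: infinite_finite_induct) (simp_all add: xterm_add xterm_zero)

lemma xterm_minus_one_power: "xterm I ((- 1) ^ k * q) = (- 1) ^ k * xterm I q"
  by (simp add: minus_one_power_mult xterm_uminus)

lemma xterm_single: "xterm I (Poly_Mapping.single R c) = pterm c (I, R)"
  by (cases "c = 0") (simp_all add: xterm_def pterm_zero)

lemma ypoly_decomp:
  "q = (\<Sum>R\<in>Poly_Mapping.keys q. Poly_Mapping.single R (Poly_Mapping.lookup q R))"
  by (rule poly_mapping_eqI) (auto simp: lookup_sum lookup_single when_def in_keys_iff)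

text \<open>No Koszul sign arises, since the y_i are even and contribute no crossings.\<close>

lemma xterm_mult_of_ypoly:
  fixes p q :: "'p :: prime_card mod_ring ypoly"
  assumes "finite I"
  shows "xterm I p * of_ypoly q = xterm I (p * q)"
proof -
  have "pterm c (I, R) * pterm d ({}, T) = xterm I (Poly_Mapping.single R c * Poly_Mapping.single T d)"
    for c d :: "'p mod_ring" and R T
  proof -
    have "(parity ^^ k) d = d" for k by (induction k) (simp_all add: parity_mod_ring_def)
    then show ?thesis using assms by (simp add: pterm_mult mult_single xterm_single)
  qed
  then have "xterm I p * of_ypoly q = xterm I
      ((\<Sum>R\<in>Poly_Mapping.keys p. Poly_Mapping.single R (Poly_Mapping.lookup p R)) *
       (\<Sum>R\<in>Poly_Mapping.keys q. Poly_Mapping.single R (Poly_Mapping.lookup q R)))"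
    by (simp add: xterm_def[of I p] of_ypoly_def sum_product xterm_sum)
  then show ?thesis by (simp flip: ypoly_decomp)
qed

text \<open>Each new factor is smaller than all those to its right, so no crossing occurs and the
  coefficient stays 1.\<close>

lemma prod_xgen:
  assumes "finite I"
  shows "prod_list (map xgen (sorted_list_of_set I)) = (pterm 1 (I, 0) :: 'p :: prime_card mod_ring gpoly)"
  using assms
proof (induction I rule: finite_linorder_min_induct)
  case empty
  then show ?case by (simp add: pterm_one)
next
  case (insert b A)
  have b: "b \<notin> A" using insert by auto
  then have "sorted_list_of_set (insert b A) = b # sorted_list_of_set A"
    using insert by (simp add: insort_is_Cons less_imp_le)
  moreover have "crossings {b} A = 0"
    unfolding crossings_def card_eq_0_iff using insert.hyps(2) by auto
  ultimately show ?case
    using insert b by (simp add: xgen_def pterm_mult parity_mod_ring_def)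
qed

text \<open>Reduces identities between brackets to polynomial identities for each \<open>I\<close>
  separately.\<close>

lemma bracket_eq_xterm:
  "(bracket k as :: 'p :: prime_card mod_ring gpoly) =
    (\<Sum>I | I \<subseteq> {1..k + length as} \<and> card I = k. xterm I
      (of_int (sign (bracket_perm (k + length as) I)) *
       ydet (sorted_list_of_set ({1..k + length as} - I)) as))"
  unfolding bracket_def Let_def
proof (intro sum.cong refl)
  let ?n = "k + length as"
  fix I assume "I \<in> {I. I \<subseteq> {1..?n} \<and> card I = k}"
  then have fin: "finite I" using finite_subset by auto
  have s: "of_int (sign \<sigma>) * xterm I q = (xterm I (of_int (sign \<sigma>) * q) :: 'p mod_ring gpoly)" for \<sigma> q
    by (simp add: sign_def xterm_uminus)
  show "of_int (sign (bracket_perm ?n I)) * prod_list (map xgen (sorted_list_of_set I)) *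
      of_ypoly (ydet (sorted_list_of_set ({1..?n} - I)) as)
    = (xterm I (of_int (sign (bracket_perm ?n I)) *
       ydet (sorted_list_of_set ({1..?n} - I)) as) :: 'p mod_ring gpoly)"
    unfolding prod_xgen[OF fin] mult.assoc
    unfolding xterm_single[symmetric] xterm_mult_of_ypoly[OF fin] single_one mult_1_left s ..
qed

section \<open>Coefficients of 1 and of \<open>tau r\<close> in the coaction\<close>

lemma add_eq_0_iff_exponents: "a + b = 0 \<longleftrightarrow> a = 0 \<and> b = 0" for a b :: "nat \<Rightarrow>\<^sub>0 nat"
proof
  assume "a + b = 0"
  then have "Poly_Mapping.lookup a i = 0 \<and> Poly_Mapping.lookup b i = 0" for i
    by (metis add_is_0 lookup_add lookup_zero)
  then show "a = 0 \<and> b = 0" by (auto intro: poly_mapping_eqI)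
qed simp

lemma splits_one: "splits ({}, 0) = {(({}, 0), ({}, 0))}"
  by (auto simp: splits_def add_eq_0_iff_exponents)

lemma splits_tau: "splits (tau r) = {(({}, 0), tau r), (tau r, ({}, 0))}"
  by (auto simp: splits_def tau_def add_eq_0_iff_exponents Un_singleton_iff)

lemma gcoeff_mult_one: "gcoeff (u * v) ({}, 0) = gcoeff u ({}, 0) * gcoeff v ({}, 0)"
  by (simp add: times_gseries.rep_eq splits_one)

text \<open>The monomial \<open>tau r\<close> factors only as 1 times itself, in either order. The
  parity is the Koszul sign for moving it past the coefficient of the second factor, so this is the
  signed Leibniz rule.\<close>

lemma gcoeff_mult_tau: "gcoeff (u * v) (tau r)
    = gcoeff u ({}, 0) * gcoeff v (tau r) + gcoeff u (tau r) * parity (gcoeff v ({}, 0))"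
  by (simp add: times_gseries.rep_eq splits_tau) (simp add: tau_def)

lemma gcoeff_one_one: "gcoeff 1 ({}, 0) = 1" "gcoeff 1 (tau r) = 0"
  by (simp_all add: one_gseries.rep_eq tau_def)

lemma gcoeff_coaction_x: "gcoeff (coaction_x i) ({}, 0) = xgen i"
  by (simp add: coaction_x_def plus_gseries.rep_eq gsum.rep_eq gcoeff_gterm tau_def)

lemma gcoeff_gsum_eq:
  assumes "\<And>s. s \<noteq> t \<Longrightarrow> gcoeff (F s) m = 0"
  shows "gcoeff (gsum F) m = gcoeff (F t) m"
proof -
  have "(\<Sum>s | gcoeff (F s) m \<noteq> 0. gcoeff (F s) m) = (\<Sum>s\<in>{t}. gcoeff (F s) m)"
    using assms by (intro sum.mono_neutral_left) auto
  then show ?thesis by (simp add: gsum.rep_eq)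
qed

lemma gcoeff_coaction_x_tau:
  "gcoeff (coaction_x i :: 'p :: prime_card mod_ring gpoly gseries) (tau r) = ygen i ^ (CARD('p) ^ r)"
proof -
  have "gcoeff (gsum (\<lambda>s. gterm (ygen i ^ (CARD('p) ^ s)) (tau s)) :: 'p mod_ring gpoly gseries) (tau r)
      = ygen i ^ (CARD('p) ^ r)"
    by (subst gcoeff_gsum_eq[of r]) (auto simp: gcoeff_gterm tau_def)
  then show ?thesis by (simp add: coaction_x_def plus_gseries.rep_eq gcoeff_gterm tau_def)
qed

text \<open>Since \<xi>_0 = 1, the term with index 0 contributes y_i itself, and no other \<xi>_s is
  the trivial monomial. None of them contains an odd generator, hence the vanishing at
  \<open>tau r\<close>.\<close>

lemma gcoeff_coaction_y: "gcoeff (coaction_y i) ({}, 0) = ygen i" "gcoeff (coaction_y i) (tau r) = 0"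
proof -
  have "Poly_Mapping.single s (1 :: nat) \<noteq> 0" for s :: nat
    by (metis lookup_single_eq lookup_zero one_neq_zero)
  then show "gcoeff (coaction_y i) ({}, 0) = ygen i"
    unfolding coaction_y_def by (subst gcoeff_gsum_eq[of 0]) (auto simp: gcoeff_gterm xi_def)
  show "gcoeff (coaction_y i) (tau r) = 0"
    unfolding coaction_y_def by (subst gcoeff_gsum_eq[of 0]) (auto simp: gcoeff_gterm xi_def tau_def)
qed

lemma ygen_power: "(ygen i :: 'p :: prime_card mod_ring gpoly) ^ k = pterm 1 ({}, Poly_Mapping.single i k)"
  by (induction k) (simp_all add: ygen_def pterm_one pterm_mult flip: single_add)

lemma gcoeff_power:
  assumes "gcoeff u (tau r) = 0"
  shows "gcoeff (u ^ k) ({}, 0) = gcoeff u ({}, 0) ^ k" "gcoeff (u ^ k) (tau r) = 0"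
  using assms by (induction k) (simp_all add: gcoeff_one_one gcoeff_mult_one gcoeff_mult_tau)

lemma gcoeff_coaction_Y:
  "gcoeff (coaction_Y R :: 'p :: prime_card mod_ring gpoly gseries) ({}, 0) = pterm 1 ({}, R)"
  "gcoeff (coaction_Y R :: 'p :: prime_card mod_ring gpoly gseries) (tau r) = 0"
proof -
  let ?f = "\<lambda>i. Poly_Mapping.single i (Poly_Mapping.lookup R i)"
  let ?P = "\<lambda>xs. prod_list (map (\<lambda>i. coaction_y i ^ Poly_Mapping.lookup R i) xs)
    :: 'p mod_ring gpoly gseries"
  have 1: "gcoeff (?P xs) ({}, 0) = pterm 1 ({}, \<Sum>i\<leftarrow>xs. ?f i)" for xs
    by (induction xs) (simp_all add: gcoeff_one_one pterm_one gcoeff_mult_one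
        gcoeff_power[OF gcoeff_coaction_y(2)] gcoeff_coaction_y ygen_power pterm_mult)
  have "gcoeff (?P xs) (tau r) = 0" for xs
    by (induction xs) (simp_all add: gcoeff_one_one gcoeff_mult_tau
        gcoeff_power[OF gcoeff_coaction_y(2)])
  then show "gcoeff (coaction_Y R :: 'p mod_ring gpoly gseries) (tau r) = 0"
    by (simp add: coaction_Y_def)
  have "(\<Sum>i\<leftarrow>sorted_list_of_set (Poly_Mapping.keys R). ?f i) = (\<Sum>i\<in>Poly_Mapping.keys R. ?f i)"
    by (subst sum_list_distinct_conv_sum_set) auto
  also have "\<dots> = R"
    by (rule poly_mapping_eqI) (auto simp: lookup_sum lookup_single when_def in_keys_iff)
  finally show "gcoeff (coaction_Y R :: 'p mod_ring gpoly gseries) ({}, 0) = pterm 1 ({}, R)"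
    by (simp add: coaction_Y_def 1)
qed

lemma gcoeff_coaction_X:
  assumes "finite S"
  shows "gcoeff (coaction_X S :: 'p :: prime_card mod_ring gpoly gseries) ({}, 0) = pterm 1 (S, 0)"
proof -
  have "gcoeff (prod_list (map coaction_x xs)) ({}, 0)
      = (prod_list (map xgen xs) :: 'p mod_ring gpoly)" for xs
    by (induction xs) (simp_all add: gcoeff_one_one gcoeff_mult_one gcoeff_coaction_x)
  then show ?thesis using assms by (simp add: coaction_X_def prod_xgen)
qed

text \<open>Each summand takes \<open>tau r\<close> from one factor and 1 from all the others; the
  sign records the odd generators to the right of the chosen factor.\<close>

lemma gcoeff_coaction_X_tau:
  assumes "finite S"
  shows "gcoeff (coaction_X S :: 'p :: prime_card mod_ring gpoly gseries) (tau r)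
    = (\<Sum>i\<in>S. (- 1) ^ card {j \<in> S. i < j} * pterm 1 (S - {i}, Poly_Mapping.single i (CARD('p) ^ r)))"
  using assms
proof (induction S rule: finite_linorder_min_induct)
  case empty
  then show ?case by (simp add: coaction_X_def gcoeff_one_one)
next
  case (insert b A)
  let ?q = "CARD('p) ^ r"
  let ?Y = "\<lambda>i. Poly_Mapping.single i ?q"
  have b: "b \<notin> A" using insert by auto
  have X: "coaction_X (insert b A) = coaction_x b * (coaction_X A :: 'p mod_ring gpoly gseries)"
    using insert by (intro coaction_X_insert) auto
  have um: "pterm (- c) m = - pterm c m" for c :: "'p mod_ring" and m
    by (rule gpoly_eqI) (simp add: pcoeff_pterm pcoeff_uminus)
  have "{j \<in> insert b A. b < j} = A" using insert.hyps(2) by auto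
  \<comment> \<open>Here \<open>tau r\<close> comes from the new leftmost factor and passes all
    generators of \<open>A\<close>.\<close>
  moreover have "ygen b ^ ?q * parity (pterm 1 (A, 0)) = ((- 1) ^ card A * pterm 1 (A, ?Y b) :: 'p mod_ring gpoly)"
    using insert.hyps(1) by (simp add: ygen_power parity_pterm parity_mod_ring_def pterm_mult um
        minus_one_power_mult)
  moreover have "insert b A - {b} = A" using b by auto
  \<comment> \<open>Here \<open>tau r\<close> comes from \<open>A\<close>; the smaller index
    \<open>b\<close> on the left changes neither the count of larger elements nor the order.\<close>
  moreover have "xgen b * ((- 1) ^ card {j \<in> A. i < j} * pterm 1 (A - {i}, ?Y i))
      = ((- 1) ^ card {j \<in> insert b A. i < j} * pterm 1 (insert b A - {i}, ?Y i) :: 'p mod_ring gpoly)"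
    if "i \<in> A" for i
  proof -
    have "{j \<in> insert b A. i < j} = {j \<in> A. i < j}" "insert b A - {i} = insert b (A - {i})"
      using insert.hyps(2) that by (auto dest: less_asym)
    moreover have "crossings {b} (A - {i}) = 0"
      unfolding crossings_def card_eq_0_iff using insert.hyps(2) by auto
    ultimately show ?thesis
      using insert.hyps(1) b by (simp add: xgen_def minus_one_power_mult pterm_mult parity_mod_ring_def)
  qed
  ultimately show ?case
    using insert.hyps(1) b
    by (simp add: X gcoeff_mult_tau gcoeff_coaction_x gcoeff_coaction_x_tau gcoeff_coaction_X
        insert.IH sum_distrib_left add.commute cong: sum.cong)
qed

section \<open>The operation on sums, monomials and products x_I q\<close>

lemma milnor_op_superset:
  assumes "finite K" "support u \<subseteq> K"
  shows "milnor_op S R u = (\<Sum>m\<in>K. (- 1) ^ (card S * (mdim m + card S)) *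
     gcoeff (coaction (pterm (pcoeff u m) m)) (S, R))"
  unfolding milnor_op_def
  using assms by (intro sum.mono_neutral_left)
    (auto simp: support_def pterm_zero coaction_zero zero_gseries.rep_eq)

text \<open>The degree-dependent sign does no harm because it is attached to each monomial
  separately; the union of the supports is a common index set.\<close>

lemma milnor_op_add: "milnor_op S R (u + v) = milnor_op S R u + milnor_op S R v"
proof -
  let ?K = "support u \<union> support v"
  have "support (u + v) \<subseteq> ?K" by (auto simp: support_def pcoeff_add)
  then show ?thesis
    by (simp add: milnor_op_superset[of ?K] finite_support pcoeff_add pterm_add coaction_add
        plus_gseries.rep_eq distrib_left sum.distrib)
qed

lemma milnor_op_zero: "milnor_op S R 0 = 0"
  using milnor_op_add[of S R 0 0] by simp

lemma milnor_op_sum: "milnor_op S R (sum f A) = (\<Sum>a\<in>A. milnor_op S R (f a))"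
  by (induction A rule: infinite_finite_induct) (simp_all add: milnor_op_add milnor_op_zero)

text \<open>For \<open>k = card I\<close> the sign convention contributes \<open>(-1)^(k - 1)\<close>, and moving \<open>\<tau>_r\<close> past the
  generators to the right of \<open>x_i\<close> contributes one sign each; what remains is one sign for each generator
  to the left of \<open>x_i\<close>.\<close>

lemma milnor_op_pterm:
  fixes c :: "'p :: prime_card mod_ring"
  assumes "finite I"
  shows "milnor_op {r} 0 (pterm c (I, R)) = (\<Sum>i\<in>I. (- 1) ^ card {j \<in> I. j < i} *
    pterm c (I - {i}, Poly_Mapping.single i (CARD('p) ^ r) + R))"
proof -
  let ?Y = "\<lambda>i. Poly_Mapping.single i (CARD('p) ^ r)"
  \<comment> \<open>The set \<open>I\<close> consists of \<open>i\<close>, the elements above it and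
    those below it. The even summand \<open>2 * k\<close> stands for the degree of the
    y-part.\<close>
  have sign: "(- 1) ^ Suc (card I + 2 * k) * ((- 1) ^ card {j \<in> I. i < j} * u)
      = (- 1) ^ card {j \<in> I. j < i} * (u :: 'p mod_ring gpoly)" if "i \<in> I" for i k u
  proof -
    have "I = insert i ({j \<in> I. i < j} \<union> {j \<in> I. j < i})" using that by auto
    then have "card I = Suc (card ({j \<in> I. i < j} \<union> {j \<in> I. j < i}))"
      using assms by (metis (no_types, lifting) Un_iff card_insert_disjoint finite_insert less_irrefl mem_Collect_eq)
    also have "\<dots> = Suc (card {j \<in> I. i < j} + card {j \<in> I. j < i})"
      using assms by (subst card_Un_disjoint) auto
    finally show ?thesis by (simp add: minus_one_power_mult)
  qed
  have "support (pterm c (I, R)) \<subseteq> {(I, R)}" by (auto simp: support_def pcoeff_pterm)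
  then have "milnor_op {r} 0 (pterm c (I, R)) = (- 1) ^ Suc (mdim (I, R)) *
      gcoeff (coaction (pterm c (I, R))) (tau r)"
    using assms by (subst milnor_op_superset[of "{(I, R)}"]) (auto simp: pcoeff_pterm tau_def)
  also have "gcoeff (coaction (pterm c (I, R))) (tau r)
      = pterm c ({}, 0) * ((\<Sum>i\<in>I. (- 1) ^ card {j \<in> I. i < j} * pterm 1 (I - {i}, ?Y i)) *
          pterm 1 ({}, R))"
  proof -
    have "gcoeff (cst c) ({}, 0) = pterm c ({}, 0)" "gcoeff (cst c) (tau r) = 0"
      by (simp_all add: cst_def gcoeff_gterm tau_def)
    moreover have "parity (pterm 1 ({}, R)) = (pterm 1 ({}, R) :: 'p mod_ring gpoly)"
      by (simp add: parity_pterm parity_mod_ring_def)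
    ultimately show ?thesis
      using assms by (simp add: coaction_pterm coaction_mono_eq gcoeff_mult_tau
          gcoeff_coaction_Y gcoeff_coaction_X_tau)
  qed
  also have "\<dots> = (\<Sum>i\<in>I. (- 1) ^ card {j \<in> I. i < j} * pterm c (I - {i}, ?Y i + R))"
  proof -
    have "(parity ^^ k) d = d" for k and d :: "'p mod_ring"
      by (induction k) (simp_all add: parity_mod_ring_def)
    then have "pterm c ({}, 0) * (pterm 1 (I - {i}, ?Y i) * pterm 1 ({}, R)) = pterm c (I - {i}, ?Y i + R)" for i
      using assms by (simp add: pterm_mult)
    then show ?thesis
      unfolding sum_distrib_left sum_distrib_right
      by (intro sum.cong refl) (simp add: minus_one_power_mult)
  qed
  also have "mdim (I, R) = card I + 2 * (\<Sum>i\<in>Poly_Mapping.keys R. Poly_Mapping.lookup R i)"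
    by (simp add: mdim_def)
  finally show ?thesis
    by (simp only: sum_distrib_left[of "(- 1) ^ Suc _"] sign cong: sum.cong)
qed

lemma milnor_op_xterm:
  fixes q :: "'p :: prime_card mod_ring ypoly"
  assumes "finite I"
  shows "milnor_op {r} 0 (xterm I q) = (\<Sum>i\<in>I. (- 1) ^ card {j \<in> I. j < i} *
    xterm (I - {i}) (yvar i ^ (CARD('p) ^ r) * q))"
proof -
  have "xterm (I - {i}) (yvar i ^ (CARD('p) ^ r) * q) = (\<Sum>R\<in>Poly_Mapping.keys q.
      pterm (Poly_Mapping.lookup q R) (I - {i}, Poly_Mapping.single i (CARD('p) ^ r) + R))" for i
  proof -
    have "yvar i ^ (CARD('p) ^ r) * q = (\<Sum>R\<in>Poly_Mapping.keys q.
        Poly_Mapping.single (Poly_Mapping.single i (CARD('p) ^ r) + R) (Poly_Mapping.lookup q R))"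
      using arg_cong[OF ypoly_decomp[of q], of "(*) (yvar i ^ (CARD('p) ^ r))"]
      by (simp add: yvar_power sum_distrib_left mult_single)
    then show ?thesis by (simp add: xterm_sum xterm_single)
  qed
  then show ?thesis
    using assms by (simp add: xterm_def[of I] milnor_op_sum milnor_op_pterm sum_distrib_left
        sum.swap[of _ I])
qed

section \<open>Operations on brackets\<close>

text \<open>Moving \<open>i\<close> from the complement into \<open>J\<close> creates one crossing
  for each smaller element of the complement and destroys one for each larger element of
  \<open>J\<close>. Together with the smaller elements of \<open>J\<close> these give
  \<open>card J\<close>. This matches the sign of the derivation with that of the Laplace
  expansion.\<close>

lemma bracket_perm_insert_sign:
  assumes "J \<subseteq> {1..n}" "i \<in> {1..n} - J"
  shows "(- 1) ^ card {j \<in> insert i J. j < i} * sign (bracket_perm n (insert i J))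
    = (- 1) ^ card J * ((- 1) ^ card {j \<in> {1..n} - J. j < i} * sign (bracket_perm n J))"
proof -
  let ?K = "{1..n} - J"
  have fin: "finite J" "finite ?K" using assms(1) finite_subset by auto
  have iJ: "i \<notin> J" "insert i J \<subseteq> {1..n}" using assms by auto
  have K: "{1..n} - insert i J = ?K - {i}" "?K = insert i (?K - {i})" using assms by auto
  have single: "crossings {i} B = card {j \<in> B. j < i}" "crossings B {i} = card {j \<in> B. i < j}" for B
  proof -
    have "{(a, b). a \<in> {i} \<and> b \<in> B \<and> b < a} = Pair i ` {j \<in> B. j < i}"
      "{(a, b). a \<in> B \<and> b \<in> {i} \<and> b < a} = (\<lambda>j. (j, i)) ` {j \<in> B. i < j}" by auto
    then show "crossings {i} B = card {j \<in> B. j < i}" "crossings B {i} = card {j \<in> B. i < j}"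
      by (simp_all add: crossings_def card_image inj_on_def)
  qed
  have "crossings (insert i J) (?K - {i}) = crossings {i} (?K - {i}) + crossings J (?K - {i})"
    using crossings_Un_left[of "{i}" J "?K - {i}"] fin iJ by simp
  moreover have "crossings J ?K = crossings J {i} + crossings J (?K - {i})"
    using crossings_Un_right[of J "{i}" "?K - {i}"] fin K(2) by simp
  moreover have "{j \<in> ?K - {i}. j < i} = {j \<in> ?K. j < i}" "{j \<in> insert i J. j < i} = {j \<in> J. j < i}"
    by auto
  moreover have "card J = card {j \<in> J. j < i} + card {j \<in> J. i < j}"
  proof -
    have "J = {j \<in> J. j < i} \<union> {j \<in> J. i < j}" using iJ by (auto simp: not_less_iff_gr_or_eq)
    then have "card J = card ({j \<in> J. j < i} \<union> {j \<in> J. i < j})" by (rule arg_cong)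
    also have "\<dots> = card {j \<in> J. j < i} + card {j \<in> J. i < j}"
      using fin by (intro card_Un_disjoint) auto
    finally show ?thesis .
  qed
  ultimately show ?thesis
    unfolding sign_bracket_perm[OF assms(1)] sign_bracket_perm[OF iJ(2)] K(1)
    by (simp add: single minus_one_power_iff)
qed

text \<open>The operation removes some x_i and multiplies by a power of y_i. Collecting the terms
  that leave the same set \<open>J\<close> of x-indices gives the expansion of a determinant along a
  new first column with exponent \<open>r\<close>.\<close>

lemma milnor_op_bracket:
  "milnor_op {r} 0 (bracket (Suc k) as :: 'p :: prime_card mod_ring gpoly)
    = (- 1) ^ k * bracket k (r # as)"
proof -
  define n where "n = Suc k + length as"
  let ?K = "{1..n}"
  let ?S = "\<lambda>k. {I. I \<subseteq> ?K \<and> card I = k}"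
  let ?D = "\<lambda>I. ydet (sorted_list_of_set I) as :: 'p mod_ring ypoly"
  let ?y = "\<lambda>i. yvar i ^ (CARD('p) ^ r) :: 'p mod_ring ypoly"
  \<comment> \<open>\<open>F I i\<close> is the term of the operation that removes x_i from the
    summand of \<open>I\<close>; \<open>G J i\<close> is the term of row \<open>i\<close> in the
    column expansion for \<open>J\<close>.\<close>
  define F :: "nat set \<Rightarrow> nat \<Rightarrow> 'p mod_ring gpoly" where
    "F I i = (- 1) ^ card {j \<in> I. j < i} *
      xterm (I - {i}) (?y i * (of_int (sign (bracket_perm n I)) * ?D (?K - I)))" for I i
  define G :: "nat set \<Rightarrow> nat \<Rightarrow> 'p mod_ring gpoly" where
    "G J i = (- 1) ^ k * xterm J (of_int (sign (bracket_perm n J)) *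
      ((- 1) ^ card {j \<in> ?K - J. j < i} * ?y i * ?D (?K - J - {i})))" for J i
  have finS: "finite (?S j)" for j by simp
  have fin: "finite I" if "I \<in> ?S j" for I j using that finite_subset by auto
  have FG: "F (insert i J) i = G J i" if J: "J \<in> ?S k" and i: "i \<in> ?K - J" for J i
  proof -
    have eq: "insert i J - {i} = J" "?K - insert i J = ?K - J - {i}" using i by auto
    have s: "of_int ((- 1) ^ card {j \<in> insert i J. j < i} * sign (bracket_perm n (insert i J)))
        = (of_int ((- 1) ^ card J * ((- 1) ^ card {j \<in> ?K - J. j < i} * sign (bracket_perm n J)))
          :: 'p mod_ring ypoly)"
      using bracket_perm_insert_sign[of J n i] J i by (simp only: mem_Collect_eq)
    have "F (insert i J) i = xterm J (of_int ((- 1) ^ card {j \<in> insert i J. j < i} *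
        sign (bracket_perm n (insert i J))) * (?y i * ?D (?K - J - {i})))"
      unfolding F_def eq by (simp add: mult_ac flip: xterm_minus_one_power)
    also have "\<dots> = G J i"
      unfolding s using J by (simp add: G_def mult_ac flip: xterm_minus_one_power)
    finally show ?thesis .
  qed
  have "milnor_op {r} 0 (bracket (Suc k) as :: 'p mod_ring gpoly) = (\<Sum>I\<in>?S (Suc k). \<Sum>i\<in>I. F I i)"
    unfolding bracket_eq_xterm n_def[symmetric] milnor_op_sum
    by (intro sum.cong refl) (simp add: milnor_op_xterm[OF fin] F_def)
  also have "\<dots> = (\<Sum>(I, i)\<in>Sigma (?S (Suc k)) (\<lambda>I. I). F I i)"
    using fin by (intro sum.Sigma finS) blast
  \<comment> \<open>A set with a marked element corresponds to a smaller set with a marked element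
    of its complement.\<close>
  also have "\<dots> = (\<Sum>(J, i)\<in>Sigma (?S k) (\<lambda>J. ?K - J). G J i)"
  proof (rule sum.reindex_bij_witness[where i = "\<lambda>(J, i). (insert i J, i)" and j = "\<lambda>(I, i). (I - {i}, i)"])
    fix a assume "a \<in> Sigma (?S (Suc k)) (\<lambda>I. I)"
    then obtain I i where a: "a = (I, i)" "I \<in> ?S (Suc k)" "i \<in> I" by blast
    then have I: "I - {i} \<in> ?S k" "i \<in> ?K - (I - {i})" "insert i (I - {i}) = I"
      using fin[OF a(2)] by auto
    then show "(case case a of (I, i) \<Rightarrow> (I - {i}, i) of (J, i) \<Rightarrow> (insert i J, i)) = a"
      "(case a of (I, i) \<Rightarrow> (I - {i}, i)) \<in> Sigma (?S k) (\<lambda>J. ?K - J)"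
      "(case case a of (I, i) \<Rightarrow> (I - {i}, i) of (J, i) \<Rightarrow> G J i) = (case a of (I, i) \<Rightarrow> F I i)"
      using FG[OF I(1,2)] unfolding a(1) by simp_all
  next
    fix b assume "b \<in> Sigma (?S k) (\<lambda>J. ?K - J)"
    then obtain J i where b: "b = (J, i)" "J \<in> ?S k" "i \<in> ?K - J" by blast
    then have "insert i J \<in> ?S (Suc k)" "insert i J - {i} = J"
      using fin[OF b(2)] by auto
    then show "(case case b of (J, i) \<Rightarrow> (insert i J, i) of (I, i) \<Rightarrow> (I - {i}, i)) = b"
      "(case b of (J, i) \<Rightarrow> (insert i J, i)) \<in> Sigma (?S (Suc k)) (\<lambda>I. I)"
      unfolding b(1) by simp_all
  qed
  also have "\<dots> = (\<Sum>J\<in>?S k. \<Sum>i\<in>?K - J. G J i)"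
    by (rule sum.Sigma[symmetric]) auto
  also have "\<dots> = (- 1) ^ k * bracket k (r # as)"
  proof -
    have n: "k + length (r # as) = n" by (simp add: n_def)
    \<comment> \<open>For fixed \<open>J\<close> the sum over \<open>i\<close> is the expansion
      along the first column.\<close>
    have "(\<Sum>i\<in>?K - J. G J i) = (- 1) ^ k * xterm J (of_int (sign (bracket_perm n J)) *
        ydet (sorted_list_of_set (?K - J)) (r # as))" if "J \<in> ?S k" for J
    proof -
      have "card (?K - J) = Suc (length [] + length as)"
        using that fin[OF that] by (simp add: card_Diff_subset n_def)
      then show ?thesis
        using ydet_expand[of "?K - J" "[]" as r, where 'p = 'p]
        by (simp add: G_def sum_distrib_left xterm_sum del: One_nat_def)
    qed
    then show ?thesis
      unfolding bracket_eq_xterm n by (simp add: sum_distrib_left)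
  qed
  finally show ?thesis .
qed

section \<open>Column rules for brackets\<close>

lemma card_complement:
  assumes "I \<subseteq> {1..k + m}" "card I = k"
  shows "finite I" "card ({1..k + m} - I) = m"
  using assms finite_subset[OF assms(1)] by (simp_all add: card_Diff_subset)

lemma bracket_move:
  "bracket k (as @ r # bs) = (- 1) ^ length as * (bracket k (r # as @ bs) :: 'p :: prime_card mod_ring gpoly)"
  unfolding bracket_eq_xterm sum_distrib_left
proof (intro sum.cong)
  fix I assume "I \<in> {I. I \<subseteq> {1..k + length (r # as @ bs)} \<and> card I = k}"
  then have I: "I \<subseteq> {1..k + Suc (length as + length bs)}" "card I = k" by auto
  have "card ({1..k + Suc (length as + length bs)} - I) = Suc (length as + length bs)"
    by (rule card_complement(2)[OF I])
  then show "xterm I (of_int (sign (bracket_perm (k + length (as @ r # bs)) I)) *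
        ydet (sorted_list_of_set ({1..k + length (as @ r # bs)} - I)) (as @ r # bs))
    = (- 1) ^ length as * (xterm I (of_int (sign (bracket_perm (k + length (r # as @ bs)) I)) *
        ydet (sorted_list_of_set ({1..k + length (r # as @ bs)} - I)) (r # as @ bs)) :: 'p mod_ring gpoly)"
    by (simp add: ydet_move mult.left_commute del: One_nat_def flip: xterm_minus_one_power)
qed simp

lemma bracket_repeat:
  assumes "r \<in> set as"
  shows "bracket k (r # as) = 0"
  unfolding bracket_eq_xterm using assms by (simp add: ydet_repeat xterm_zero)

text \<open>The Dickson relation has the same coefficients in every row, so it can be substituted
  into the first column of each determinant; being independent of \<open>I\<close>, the coefficients
  then factor out of the bracket.\<close>

lemma bracket_top:
  assumes "n = k + Suc (length as)"
  shows "(bracket k (n # as) :: 'p :: prime_card mod_ring gpoly)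
    = (\<Sum>t<n. (- 1) ^ (n + t + 1) * (bracket k (t # as) * of_ypoly (dickson n t)))"
proof -
  let ?S = "{I. I \<subseteq> {1..n} \<and> card I = k}"
  let ?b = "\<lambda>I t. of_int (sign (bracket_perm n I)) * ydet (sorted_list_of_set ({1..n} - I)) (t # as)
    :: 'p mod_ring ypoly"
  have n: "k + length (t # as) = n" for t using assms by simp
  have "xterm I (?b I n) = (\<Sum>t<n. (- 1) ^ (n + t + 1) * (xterm I (?b I t) * of_ypoly (dickson n t)))"
    if "I \<in> ?S" for I
  proof -
    have I: "finite I" "card ({1..n} - I) = Suc (length as)"
      using that card_complement[of I k "Suc (length as)"] assms by auto
    have "ydet (sorted_list_of_set ({1..n} - I)) (n # as)
        = (\<Sum>t<n. ((- 1) ^ (n + t + 1) * dickson n t) *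
            (ydet (sorted_list_of_set ({1..n} - I)) (t # as) :: 'p mod_ring ypoly))"
      by (rule ydet_linear) (use I dickson_relation in auto)
    then have "?b I n = (\<Sum>t<n. (- 1) ^ (n + t + 1) * (?b I t * dickson n t))"
      by (simp only: sum_distrib_left) (simp add: mult_ac)
    then show ?thesis
      by (simp only: xterm_sum xterm_minus_one_power xterm_mult_of_ypoly[OF I(1)])
  qed
  then show ?thesis
    unfolding bracket_eq_xterm n sum_distrib_right sum_distrib_left
    by (subst sum.swap) (rule sum.cong[OF refl], simp)
qed

section \<open>Evaluation on the Mui invariants\<close>

theorem proposition4p5:
  fixes n k r :: nat and s :: "nat \<Rightarrow> nat"
  assumes "odd CARD('p :: prime_card)"
    and "n \<ge> 1" and "1 \<le> k" and "k \<le> n"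
    and "strict_mono_on {1..k} s" and "\<forall>t\<in>{1..k}. s t \<le> n - 1"
    and "r \<le> n"
  shows "(\<forall>t\<in>{1..k}. r = s t \<longrightarrow>
        milnor_op {r} 0 (mui n (map s [1..<k + 1]) :: 'p mod_ring gpoly) =
          (- 1) ^ (k + s t - t) * mui n (map s (filter (\<lambda>i. i \<noteq> t) [1..<k + 1])))
    \<and> (r = n \<longrightarrow>
        milnor_op {r} 0 (mui n (map s [1..<k + 1]) :: 'p mod_ring gpoly) =
          (\<Sum>t=1..k. (- 1) ^ (n + k + t + 1) *
             mui n (map s (filter (\<lambda>i. i \<noteq> t) [1..<k + 1])) * of_ypoly (dickson n (s t))))
    \<and> (r \<noteq> n \<and> (\<forall>t\<in>{1..k}. r \<noteq> s t) \<longrightarrow>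
        milnor_op {r} 0 (mui n (map s [1..<k + 1]) :: 'p mod_ring gpoly) = 0)"
proof -
  define S where "S = s ` {1..k}"
  \<comment> \<open>The column exponents of the given Mui invariant, from which all
    \<open>s t\<close> are missing.\<close>
  define as where "as = filter (\<lambda>j. j \<notin> S) [0..<n]"
  let ?M = "\<lambda>t. mui n (map s (filter (\<lambda>i. i \<noteq> t) [1..<k + 1])) :: 'p mod_ring gpoly"
  obtain k' where k: "k = Suc k'" using assms(3) by (cases k) auto
  have inj: "inj_on s {1..k}" using assms(5) strict_mono_on_imp_inj_on by blast
  have sn: "s t < n" if "t \<in> {1..k}" for t using assms(2,6) that by fastforce
  have sS: "S \<subseteq> {0..<n}" using sn by (auto simp: S_def)
  have upt: "set [1..<k + 1] = {1..k}" by auto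
  have len: "length as = n - k"
  proof -
    have "length as = card (set as)" unfolding as_def by (rule distinct_card[symmetric]) simp
    also have "set as = {0..<n} - S" by (auto simp: as_def)
    finally show ?thesis
      using sS inj by (simp add: card_Diff_subset finite_subset S_def card_image)
  qed
  have M: "milnor_op {r} 0 (mui n (map s [1..<k + 1]) :: 'p mod_ring gpoly) = (- 1) ^ k' * bracket k' (r # as)"
  proof -
    have "length (map s [1..<k + 1]) = Suc k'" by (simp add: k del: upt_Suc)
    then show ?thesis
      unfolding mui_def set_map upt S_def[symmetric] as_def[symmetric] by (simp only: milnor_op_bracket)
  qed
  \<comment> \<open>Filling the gap \<open>s t\<close> produces the Mui bracket with
    \<open>s t\<close> dropped from its index list. The bound keeps the natural-number subtraction
    exact.\<close>
  have move: "t \<le> s t + 1" "bracket k' (s t # as) = (- 1) ^ (s t + 1 - t) * ?M t" if t: "t \<in> {1..k}" for t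
  proof -
    define A where "A = filter (\<lambda>j. j \<notin> S) [0..<s t]"
    define B where "B = filter (\<lambda>j. j \<notin> S) [Suc (s t)..<n]"
    have st: "s t \<in> S" using t by (auto simp: S_def)
    note split = upt_split[OF sn[OF t]]
    have as: "as = A @ B" unfolding as_def split using st by (simp add: A_def B_def)
    have Sd: "s ` ({1..k} - {t}) = S - {s t}" unfolding S_def using inj_on_image_set_diff[OF inj, of "{1..k}" "{t}"] t by simp
    have "filter (\<lambda>j. j \<notin> S - {s t}) [0..<n] = A @ s t # B"
    proof -
      have "filter (\<lambda>j. j \<notin> S - {s t}) xs = filter (\<lambda>j. j \<notin> S) xs" if "s t \<notin> set xs" for xs
        using that by (intro filter_cong) auto
      then show ?thesis unfolding split A_def B_def by simp
    qed
    moreover have "set (filter (\<lambda>i. i \<noteq> t) [1..<k + 1]) = {1..k} - {t}" by auto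
    moreover have "length (filter (\<lambda>i. i \<noteq> t) [1..<k + 1]) = k'"
    proof -
      have "length (filter (\<lambda>i. i \<noteq> t) [1..<k + 1]) = card (set (filter (\<lambda>i. i \<noteq> t) [1..<k + 1]))"
        by (rule distinct_card[symmetric]) simp
      also have "set (filter (\<lambda>i. i \<noteq> t) [1..<k + 1]) = {1..k} - {t}" by auto
      finally show ?thesis using t k by simp
    qed
    ultimately have Mt: "?M t = bracket k' (A @ s t # B)"
      by (simp only: mui_def set_map Sd length_map)
    \<comment> \<open>Of the \<open>s t\<close> numbers below \<open>s t\<close>, monotonicity
      leaves out exactly the \<open>t - 1\<close> values of \<open>s\<close> at smaller
      arguments.\<close>
    have "length A + card (S \<inter> {0..<s t}) = s t"
    proof -
      have "length A = card (set A)" unfolding A_def by (rule distinct_card[symmetric]) simp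
      also have "set A = {0..<s t} - (S \<inter> {0..<s t})" by (auto simp: A_def)
      finally show ?thesis
        using card_mono[of "{0..<s t}" "S \<inter> {0..<s t}"] by (simp add: card_Diff_subset)
    qed
    moreover have "S \<inter> {0..<s t} = s ` {1..<t}"
    proof -
      have "s u < s t \<longleftrightarrow> u < t" if "u \<in> {1..k}" for u
        using assms(5) t that by (metis linorder_cases order_less_asym strict_mono_onD order_less_irrefl)
      then show ?thesis using t by (auto simp: S_def)
    qed
    moreover have "card (s ` {1..<t}) = t - 1"
      using inj t by (subst card_image) (auto intro: inj_on_subset)
    ultimately have "length A + (t - 1) = s t" by simp
    then have A: "length A + t = s t + 1" using t unfolding atLeastAtMost_iff by linarith
    then show "t \<le> s t + 1" by linarith
    have "s t + 1 - t = length A" using A by simp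
    then show "bracket k' (s t # as) = (- 1) ^ (s t + 1 - t) * ?M t"
      unfolding Mt as bracket_move by (simp add: minus_one_power_mult)
  qed
  show ?thesis
  proof (intro conjI ballI impI)
    fix t assume t: "t \<in> {1..k}" "r = s t"
    have "even (k + s t - t) \<longleftrightarrow> even (k' + (s t + 1 - t))"
      using move(1)[OF t(1)] t(1) k by (simp add: even_diff_nat)
    then show "milnor_op {r} 0 (mui n (map s [1..<k + 1]) :: 'p mod_ring gpoly) = (- 1) ^ (k + s t - t) * ?M t"
      unfolding M unfolding t(2) move(2)[OF t(1)] by (simp add: minus_one_power_mult del: upt_Suc)
  next
    assume r: "r = n"
    have "n = k' + Suc (length as)" using len assms(4) k by simp
    then have "bracket k' (n # as)
        = (\<Sum>u<n. (- 1) ^ (n + u + 1) * (bracket k' (u # as) * of_ypoly (dickson n u)) :: 'p mod_ring gpoly)"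
      by (rule bracket_top)
    \<comment> \<open>An exponent below \<open>n\<close> outside \<open>S\<close> already occurs in
      \<open>as\<close>, so its bracket has a repeated column.\<close>
    also have "\<dots> = (\<Sum>u\<in>S. (- 1) ^ (n + u + 1) * (bracket k' (u # as) * of_ypoly (dickson n u)))"
      using sS by (intro sum.mono_neutral_right) (auto simp: as_def bracket_repeat)
    also have "\<dots> = (\<Sum>t=1..k. (- 1) ^ (n + s t + 1) * (bracket k' (s t # as) * of_ypoly (dickson n (s t))))"
      unfolding S_def using inj by (simp add: sum.reindex)
    finally have "(- 1) ^ k' * (bracket k' (n # as) :: 'p mod_ring gpoly) = (\<Sum>t=1..k.
        (- 1) ^ k' * ((- 1) ^ (n + s t + 1) * (bracket k' (s t # as) * of_ypoly (dickson n (s t)))))"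
      by (simp only: sum_distrib_left)
    also have "\<dots> = (\<Sum>t=1..k. (- 1) ^ (n + k + t + 1) * ?M t * of_ypoly (dickson n (s t)))"
    proof (intro sum.cong refl)
      fix t assume t: "t \<in> {1..k}"
      \<comment> \<open>The value \<open>s t\<close> enters the right-hand exponent twice, once from
        the Dickson relation and once from moving the column, so it drops out modulo 2.\<close>
      have parity: "even (n + k + t + 1) \<longleftrightarrow> even (k' + (n + s t + 1 + (s t + 1 - t)))"
        using move(1)[OF t] k by (simp add: even_diff_nat) blast
      show "(- 1) ^ k' * ((- 1) ^ (n + s t + 1) * (bracket k' (s t # as) * of_ypoly (dickson n (s t))))
        = (- 1) ^ (n + k + t + 1) * ?M t * of_ypoly (dickson n (s t))"
        unfolding move(2)[OF t] mult.assoc[symmetric] power_add[symmetric]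
        unfolding minus_one_power_iff parity ..
    qed
    finally show "milnor_op {r} 0 (mui n (map s [1..<k + 1]) :: 'p mod_ring gpoly) =
        (\<Sum>t=1..k. (- 1) ^ (n + k + t + 1) * ?M t * of_ypoly (dickson n (s t)))"
      unfolding M unfolding r .
  next
    assume "r \<noteq> n \<and> (\<forall>t\<in>{1..k}. r \<noteq> s t)"
    then have "r \<in> set as" using assms(7) by (auto simp: as_def S_def)
    then show "milnor_op {r} 0 (mui n (map s [1..<k + 1]) :: 'p mod_ring gpoly) = 0"
      unfolding M by (simp add: bracket_repeat)
  qed
qed

end
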